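(* Assume that Vojta's conjecture with truncated counting function (stated in the context below) is true for $\mathbb{P}^N$ over $\mathbb{Q}$. Let $f:\mathbb{P}^N\to\mathbb{P}^N$ be a morphism of degree $d\ge 3$ defined over $\mathbb{Q}$. Let $F(X_0,\ldots,X_N)\in\mathbb{Z}[X_0,\ldots,X_N]$ be a non-constant homogeneous polynomial such that the locus $F=0$ in $\mathbb{P}^N$ is a reduced normal crossings hypersurface, and assume that \[ \deg(F) > (N+1)\left(1+\frac{1}{d-2}\right). \] Let $P\in\mathbb{P}^N(\mathbb{Q})$ and let $\mathcal{P}=\bigl(F(f^n(P))\bigr)_{n\ge 0}\subset\mathbb{Z}$ be the sequence of values of $F$ at the points of the $f$-orbit of $P$. Then the set \[ \bigl\{ f^n(P) : n\in\mathcal{Z}(\mathcal{P})\bigr\} \] is not Zariski dense in $\mathbb{P}^N$.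
   Context: Points of $\mathbb{P}^N(\mathbb{Q})$ are always written in normalized form $[x_0,\ldots,x_N]$ with $x_i\in\mathbb{Z}$ and $\gcd(x_0,\ldots,x_N)=1$, and $F(Q)$ is evaluated on these normalized coordinates; $f^n$ denotes the $n$-th iterate of $f$. For a sequence of integers $\mathcal{A}=(a_n)_{n\ge0}$, a prime $p$ is a primitive prime divisor of $a_n$ if $p\mid a_n$ but $p\nmid a_m$ for all $0\le m<n$ with $a_m\neq 0$. The Zsigmondy set is $\mathcal{Z}(\mathcal{A})=\{n\ge 0: a_n \text{ has no primitive prime divisors}\}$. An effective divisor $D=\sum n_iD_i$ ($D_i$ irreducible) is normal crossings if $\bigcup|D_i|$ has normal crossings, and reduced if all $n_i=1$. Vojta's conjecture with truncated counting function (for a smooth projective variety $X$ over a number field $K$): let $M_K$ be a complete set of inequivalent absolute values of $K$, normalized so that the Weil height $h_D$ for a divisor $D$ decomposes as $h_D=\sum_{v\in M_K}\lambda_{D,v}$ into local heights, with $\lambda_{D,v}\ge 0$ for effective $D$ and nonarchimedean $v$. For a finite set $S\subset M_K$ containing the archimedean places and $P\in X(K)\setminus|D|$, the truncated counting function is $N_S^{(1)}(D,P)=\sum_{\mathfrak{p}\notin S,\ \lambda_{D,\mathfrak{p}}(P)>0}\log N_{\mathfrak{p}}$, where $N_\mathfrak{p}$ is the size of the residue field at $\mathfrak{p}$. The conjecture asserts: for every such $S$, every normal crossings divisor $D$ on $X$, canonical divisor $\kappa_X$, ample $H$, and every $\epsilon>0$, there is a proper Zariski closed $Y=Y(X,D,H,\epsilon)\subset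 X$ such that for all $C\ge0$, the inequality $N_S^{(1)}(D,P)\ge h_{\kappa_X+D}(P)-\epsilon h_H(P)-C$ holds for all but finitely many $P\in(X\setminus Y)(K)$. *)

theory Defs
  imports
    "HOL-Analysis.Analysis"
    "HOL-Library.Poly_Mapping"
    "HOL-Computational_Algebra.Computational_Algebra"
begin

section \<open>Forms\<close>

text \<open>
  Projective \<open>N\<close>-space has homogeneous coordinates indexed by a finite type \<open>'n\<close> with \<open>N + 1\<close>
  elements. Polynomials in these coordinates are finitely supported functions on exponent vectors;
  the ring structure is the convolution product of \<^theory>\<open>HOL-Library.Poly_Mapping\<close>. The linear
  order on \<open>'n\<close> only serves to select one representative out of \<open>\<plusminus>p\<close> and \<open>\<plusminus>x\<close> below.
\<close>

type_synonym ('n, 'a) mvpoly = "('n \<Rightarrow>\<^sub>0 nat) \<Rightarrow>\<^sub>0 'a"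

definition mvar :: "'n \<Rightarrow> ('n, int) mvpoly" where
  "mvar i = Poly_Mapping.single (Poly_Mapping.single i 1) 1"

text \<open>\<open>\<phi>\<close> is the embedding of the coefficients into the ring in which the value is taken.\<close>

definition peval :: "('b::zero \<Rightarrow> 'a::comm_semiring_1) \<Rightarrow> ('n::finite, 'b) mvpoly \<Rightarrow> 'a^'n \<Rightarrow> 'a" where
  "peval \<phi> p x = (\<Sum>m\<in>Poly_Mapping.keys p.
     \<phi> (Poly_Mapping.lookup p m) * (\<Prod>i\<in>UNIV. (x $ i) ^ Poly_Mapping.lookup m i))"

definition mdeg :: "('n::finite \<Rightarrow>\<^sub>0 nat) \<Rightarrow> nat" where
  "mdeg m = (\<Sum>i\<in>UNIV. Poly_Mapping.lookup m i)"

definition total_degree :: "('n::finite, 'b::zero) mvpoly \<Rightarrow> nat" where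
  "total_degree p = Max (insert 0 (mdeg ` Poly_Mapping.keys p))"

definition homogeneous :: "nat \<Rightarrow> ('n::finite, 'b::zero) mvpoly \<Rightarrow> bool" where
  "homogeneous d p \<longleftrightarrow> (\<forall>m\<in>Poly_Mapping.keys p. mdeg m = d)"


section \<open>Points, Zariski topology and morphisms\<close>

text \<open>
  A point of \<open>\<P>\<^sup>N(\<rat>)\<close> is its normalized coordinate vector. The sign left undetermined by
  coprimality is fixed by making the first nonzero coordinate positive.
\<close>

definition rat_points :: "(int^'n::{finite,linorder}) set" where
  "rat_points = {x. Gcd (range (\<lambda>i. x $ i)) = 1 \<and>
     (\<forall>i. (\<forall>j<i. x $ j = 0) \<longrightarrow> 0 \<le> x $ i)}"

definition complex_coords :: "int^'n \<Rightarrow> complex^'n::finite" where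
  "complex_coords x = (\<chi> i. of_int (x $ i))"

text \<open>
  Subsets of \<open>\<P>\<^sup>N(\<complex>)\<close> are handled through their preimages in the space of nonzero
  coordinate vectors; the whole of \<open>\<P>\<^sup>N\<close> is \<open>- {0}\<close>.
\<close>

definition zariski_closed :: "(complex^'n::finite) set \<Rightarrow> bool" where
  "zariski_closed Y \<longleftrightarrow> (\<exists>G :: ('n, rat) mvpoly set.
     (\<forall>g\<in>G. \<exists>d. homogeneous d g) \<and> Y = {z. z \<noteq> 0 \<and> (\<forall>g\<in>G. peval of_rat g z = 0)})"

definition zariski_dense :: "(int^'n::finite) set \<Rightarrow> bool" where
  "zariski_dense T \<longleftrightarrow> (\<forall>Y. zariski_closed Y \<and> complex_coords ` T \<subseteq> Y \<longrightarrow> Y = - {0})"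

definition form_locus :: "('n::finite, int) mvpoly \<Rightarrow> (complex^'n) set" where
  "form_locus p = {z. z \<noteq> 0 \<and> peval of_int p z = 0}"

text \<open>A morphism \<open>[f\<^sub>0, \<dots>, f\<^sub>N]\<close> of degree \<open>d\<close> defined over \<open>\<rat>\<close>.\<close>

definition morphism_of_degree :: "nat \<Rightarrow> ('n::finite \<Rightarrow> ('n, rat) mvpoly) \<Rightarrow> bool" where
  "morphism_of_degree d f \<longleftrightarrow> (\<forall>i. homogeneous d (f i)) \<and>
     (\<forall>z. z \<noteq> 0 \<longrightarrow> (\<exists>i. peval of_rat (f i) z \<noteq> (0::complex)))"

definition proj_map ::
  "('n::{finite,linorder} \<Rightarrow> ('n, rat) mvpoly) \<Rightarrow> (int, 'n) vec \<Rightarrow> (int, 'n) vec" where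
  "proj_map f x = (THE y. y \<in> rat_points \<and>
     (\<exists>c. c \<noteq> 0 \<and> (\<forall>i. peval id (f i) (\<chi> j. of_int (x $ j)) = c * of_int (y $ i))))"


section \<open>Zsigmondy sets\<close>

definition primitive_prime_divisor :: "(nat \<Rightarrow> int) \<Rightarrow> nat \<Rightarrow> nat \<Rightarrow> bool" where
  "primitive_prime_divisor a n p \<longleftrightarrow> prime p \<and> int p dvd a n \<and>
     (\<forall>m<n. a m \<noteq> 0 \<longrightarrow> \<not> int p dvd a m)"

definition zsigmondy_set :: "(nat \<Rightarrow> int) \<Rightarrow> nat set" where
  "zsigmondy_set a = {n. \<not> (\<exists>p. primitive_prime_divisor a n p)}"


section \<open>Normal crossings\<close>

definition holomorphic_vec :: "(complex^'n::finite \<Rightarrow> complex) \<Rightarrow> (complex^'n) set \<Rightarrow> bool" where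
  "holomorphic_vec g U \<longleftrightarrow> (\<forall>w\<in>U. \<exists>L. (g has_derivative L) (at w) \<and> (\<forall>c v. L (c *s v) = c * L v))"

definition dir_deriv :: "(complex^'n::finite \<Rightarrow> complex) \<Rightarrow> complex^'n \<Rightarrow> complex^'n \<Rightarrow> complex" where
  "dir_deriv g z v = deriv (\<lambda>t. g (z + t *s v)) 0"

text \<open>
  The slice \<open>{w. w $ j = z $ j}\<close> with \<open>z $ j \<noteq> 0\<close> is the affine chart \<open>X\<^sub>j \<noteq> 0\<close>, with tangent
  space \<open>{v. v $ j = 0}\<close>. Near \<open>z\<close> the set has to be the union of the coordinate hyperplanes
  \<open>g\<^sub>0 = 0, \<dots>, g\<^sub>r\<^sub>-\<^sub>1 = 0\<close> of functions that are part of a system of local holomorphic coordinates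
  of this chart. Components are allowed to cross themselves.
\<close>

definition normal_crossings :: "(complex^'n::finite) set \<Rightarrow> bool" where
  "normal_crossings Z \<longleftrightarrow> (\<forall>z j. z $ j \<noteq> 0 \<longrightarrow>
     (\<exists>U (r::nat) g. open U \<and> z \<in> U \<and>
       (\<forall>k<r. holomorphic_vec (g k) U \<and> g k z = 0) \<and>
       (\<forall>c :: nat \<Rightarrow> complex. (\<forall>v. v $ j = 0 \<longrightarrow> (\<Sum>k<r. c k * dir_deriv (g k) z v) = 0)
          \<longrightarrow> (\<forall>k<r. c k = 0)) \<and>
       (\<forall>w\<in>U. w $ j = z $ j \<longrightarrow> (w \<in> Z \<longleftrightarrow> (\<exists>k<r. g k w = 0)))))"

text \<open>
  The hypersurface \<open>p = 0\<close> over \<open>\<rat>\<close> is reduced. Square factors of positive degree are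
  excluded; the integer content of \<open>p\<close> is irrelevant.
\<close>

definition reduced_form :: "('n::finite, int) mvpoly \<Rightarrow> bool" where
  "reduced_form p \<longleftrightarrow> p \<noteq> 0 \<and> (\<forall>q. q ^ 2 dvd p \<longrightarrow> total_degree q = 0)"


section \<open>Divisors on projective space over the rationals\<close>

text \<open>
  Irreducible hypersurfaces over \<open>\<rat>\<close> correspond to the irreducible forms of positive
  degree in \<open>\<int>[X\<^sub>0, \<dots>, X\<^sub>N]\<close> (these are automatically primitive) up to sign.
\<close>

definition prime_form :: "('n::{finite,linorder}, int) mvpoly \<Rightarrow> bool" where
  "prime_form p \<longleftrightarrow> irreducible p \<and> (\<exists>d>0. homogeneous d p) \<and>
     Poly_Mapping.lookup p (Max (Poly_Mapping.keys p)) > 0"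

type_synonym 'n divisor = "('n, int) mvpoly \<Rightarrow>\<^sub>0 int"

definition is_divisor :: "'n::{finite,linorder} divisor \<Rightarrow> bool" where
  "is_divisor D \<longleftrightarrow> (\<forall>p\<in>Poly_Mapping.keys D. prime_form p)"

definition effective :: "'n divisor \<Rightarrow> bool" where
  "effective D \<longleftrightarrow> (\<forall>p. 0 \<le> Poly_Mapping.lookup D p)"

definition reduced_divisor :: "'n divisor \<Rightarrow> bool" where
  "reduced_divisor D \<longleftrightarrow> (\<forall>p\<in>Poly_Mapping.keys D. Poly_Mapping.lookup D p = 1)"

definition divisor_support :: "'n::finite divisor \<Rightarrow> (complex^'n) set" where
  "divisor_support D = (\<Union>p\<in>Poly_Mapping.keys D. form_locus p)"

definition divisor_degree :: "'n::finite divisor \<Rightarrow> int" where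
  "divisor_degree D = (\<Sum>p\<in>Poly_Mapping.keys D. Poly_Mapping.lookup D p * int (total_degree p))"

text \<open>\<open>D\<close> is the divisor of zeros of the form \<open>A\<close>.\<close>

definition zero_divisor :: "('n::{finite,linorder}, int) mvpoly \<Rightarrow> 'n divisor \<Rightarrow> bool" where
  "zero_divisor A D \<longleftrightarrow> is_divisor D \<and> effective D \<and>
     (\<exists>c::int. c \<noteq> 0 \<and> A = of_int c * (\<Prod>p\<in>Poly_Mapping.keys D. p ^ nat (Poly_Mapping.lookup D p)))"

text \<open>\<open>D - E\<close> is the divisor of the rational function \<open>A / B\<close>.\<close>

definition linearly_equivalent :: "'n::{finite,linorder} divisor \<Rightarrow> 'n divisor \<Rightarrow> bool" where
  "linearly_equivalent D E \<longleftrightarrow> (\<exists>A B D\<^sub>A D\<^sub>B d. homogeneous d A \<and> homogeneous d B \<and>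
     zero_divisor A D\<^sub>A \<and> zero_divisor B D\<^sub>B \<and> D - E = D\<^sub>A - D\<^sub>B)"

text \<open>
  The differential \<open>d(X\<^sub>i / X\<^sub>j) \<and> \<dots>\<close> (over all \<open>i \<noteq> j\<close>) has divisor \<open>- (N + 1) (X\<^sub>j = 0)\<close>, and every
  other rational \<open>N\<close>-form is a rational function times it.
\<close>

definition canonical_divisor :: "'n::{finite,linorder} divisor \<Rightarrow> bool" where
  "canonical_divisor \<kappa> \<longleftrightarrow> is_divisor \<kappa> \<and>
     (\<exists>j. linearly_equivalent \<kappa> (frag_cmul (- int CARD('n)) (frag_of (mvar j))))"

text \<open>
  Sections of \<open>E\<close> are represented by forms whose divisor of zeros lies in the linear system \<open>|E|\<close>.
  Finitely many of them have to define a closed immersion of \<open>\<P>\<^sup>N\<close>: no base points,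
  injective on geometric points, injective on tangent spaces. For the last condition the tangent
  space of \<open>\<P>\<^sup>N\<close> at \<open>z\<close> is \<open>\<complex>\<^sup>N\<^sup>+\<^sup>1 / \<complex>z\<close>.
\<close>

definition very_ample :: "'n::{finite,linorder} divisor \<Rightarrow> bool" where
  "very_ample E \<longleftrightarrow> is_divisor E \<and> (\<exists>As :: ('n, int) mvpoly set. finite As \<and>
     (\<forall>A\<in>As. (\<exists>d. homogeneous d A) \<and> (\<exists>D. zero_divisor A D \<and> linearly_equivalent D E)) \<and>
     (\<forall>z. z \<noteq> 0 \<longrightarrow> (\<exists>A\<in>As. peval of_int A z \<noteq> (0::complex))) \<and>
     (\<forall>z w. z \<noteq> 0 \<and> w \<noteq> 0 \<and> (\<exists>c::complex. \<forall>A\<in>As. peval of_int A w = c * peval of_int A z)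
        \<longrightarrow> (\<exists>c. w = c *s z)) \<and>
     (\<forall>z v. z \<noteq> 0 \<and> (\<exists>c::complex. \<forall>A\<in>As. dir_deriv (peval of_int A) z v = c * peval of_int A z)
        \<longrightarrow> (\<exists>c. v = c *s z)))"

definition ample :: "'n::{finite,linorder} divisor \<Rightarrow> bool" where
  "ample H \<longleftrightarrow> is_divisor H \<and> (\<exists>m>0. very_ample (frag_cmul m H))"


section \<open>Heights\<close>

datatype place = Archimedean | Nonarchimedean nat

definition rat_places :: "place set" where
  "rat_places = insert Archimedean (Nonarchimedean ` {p. prime p})"

fun abs_at :: "place \<Rightarrow> int \<Rightarrow> real" where
  "abs_at Archimedean a = \<bar>real_of_int a\<bar>"
| "abs_at (Nonarchimedean p) a = (if a = 0 then 0 else 1 / real p ^ multiplicity (int p) a)"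

definition max_abs_at :: "place \<Rightarrow> int^'n::finite \<Rightarrow> real" where
  "max_abs_at v x = Max (range (\<lambda>i. abs_at v (x $ i)))"

text \<open>The standard local height; meaningful for points outside the support of \<open>D\<close>.\<close>

definition local_height :: "'n::finite divisor \<Rightarrow> place \<Rightarrow> int^'n \<Rightarrow> real" where
  "local_height D v x = (\<Sum>p\<in>Poly_Mapping.keys D. real_of_int (Poly_Mapping.lookup D p) *
     (real (total_degree p) * ln (max_abs_at v x) - ln (abs_at v (peval id p x))))"

text \<open>
  The Weil height of a divisor of degree \<open>e\<close> is \<open>e\<close> times the height of the point. This is defined
  also on the support of \<open>D\<close>; off the support it is the sum of the local heights, see
  \<open>weil_height_decomposition\<close>.
\<close>

definition weil_height :: "'n::finite divisor \<Rightarrow> int^'n \<Rightarrow> real" where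
  "weil_height D x = real_of_int (divisor_degree D) * ln (max_abs_at Archimedean x)"

definition truncated_counting :: "place set \<Rightarrow> 'n::finite divisor \<Rightarrow> int^'n \<Rightarrow> real" where
  "truncated_counting S D x =
     (\<Sum>p | prime p \<and> Nonarchimedean p \<notin> S \<and> local_height D (Nonarchimedean p) x > 0. ln (real p))"


section \<open>Vojta's conjecture\<close>

text \<open>
  The divisor \<open>D\<close> is reduced: with multiplicities allowed, the inequality fails for
  every large multiple of a hyperplane.
\<close>

definition vojta_truncated :: "'n::{finite,linorder} itself \<Rightarrow> bool" where
  "vojta_truncated _ \<longleftrightarrow>
     (\<forall>S (D :: 'n divisor) \<kappa> H (\<epsilon>::real).
        finite S \<and> S \<subseteq> rat_places \<and> Archimedean \<in> S \<and>
        is_divisor D \<and> effective D \<and> reduced_divisor D \<and> normal_crossings (divisor_support D) \<and>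
        canonical_divisor \<kappa> \<and> ample H \<and> \<epsilon> > 0
      \<longrightarrow> (\<exists>Y. zariski_closed Y \<and> Y \<noteq> - {0} \<and>
            (\<forall>C\<ge>0. finite {x \<in> rat_points. complex_coords x \<notin> Y \<and>
               complex_coords x \<notin> divisor_support D \<and>
               \<not> truncated_counting S D x \<ge> weil_height (\<kappa> + D) x - \<epsilon> * weil_height H x - C})))"

section \<open>Consistency of the conventions\<close>

lemma rat_points_representative:
  fixes y :: "(rat, 'n::{finite,linorder}) vec"
  assumes "y \<noteq> 0"
  shows "\<exists>!x. x \<in> rat_points \<and> (\<exists>c. c \<noteq> 0 \<and> (\<forall>i. y $ i = c * of_int (x $ i)))"
proof -
  have first: "\<exists>i. f i \<noteq> 0 \<and> (\<forall>j<i. f j = 0)" if "\<exists>i. f i \<noteq> 0" for f :: "'n \<Rightarrow> int"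
  proof -
    define i where "i = Min {i. f i \<noteq> 0}"
    have "i \<in> {i. f i \<noteq> 0}" unfolding i_def using that by (intro Min_in) auto
    moreover have "f j = 0" if "j < i" for j
      using that unfolding i_def by (metis (mono_tags, lifting) Min_le finite mem_Collect_eq not_le)
    ultimately show ?thesis by auto
  qed
  have nz: "\<exists>i. x $ i \<noteq> 0" if "x \<in> rat_points" for x :: "(int, 'n) vec"
    using that by (rule contrapos_pp) (simp add: rat_points_def)
  define b where "b = (\<Prod>i\<in>UNIV. snd (quotient_of (y $ i)))"
  have b0: "b \<noteq> 0"
    by (metis (no_types, lifting) b_def finite less_irrefl prod_zero_iff quotient_of_denom_pos')
  have "\<exists>z. of_int b * y $ i = rat_of_int z" for i
  proof -
    obtain p q where pq: "quotient_of (y $ i) = (p, q)" by fastforce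
    have "q dvd b" unfolding b_def using dvd_prodI[of UNIV i "\<lambda>i. snd (quotient_of (y $ i))"] pq by simp
    then obtain k where "b = q * k" by blast
    moreover have "y $ i = of_int p / of_int q" "q \<noteq> 0"
      using quotient_of_div[OF pq] quotient_of_denom_pos[OF pq] by auto
    ultimately have "of_int b * y $ i = rat_of_int (k * p)" by simp
    then show ?thesis by blast
  qed
  then obtain z where z: "\<And>i. of_int b * y $ i = rat_of_int (z i)" by metis
  from assms obtain i0 where "y $ i0 \<noteq> 0" by (auto simp: vec_eq_iff)
  with z[of i0] b0 have "z i0 \<noteq> 0" by auto
  then obtain k where k: "z k \<noteq> 0" "\<And>j. j < k \<Longrightarrow> z j = 0" using first[of z] by blast
  define g where "g = Gcd (range z)"
  have g0: "g \<noteq> 0" using k(1) by (auto simp: g_def)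
  have gdvd: "g dvd z i" for i by (simp add: g_def)
  define s where "s = sgn (z k)"
  have s: "s * s = 1" "s \<noteq> 0" using k(1) by (auto simp: s_def sgn_if)
  define x :: "(int, 'n) vec" where "x = (\<chi> i. s * (z i div g))"
  have zx: "z i = s * g * x $ i" for i
  proof -
    have "s * g * x $ i = (s * s) * (g * (z i div g))" by (simp add: x_def algebra_simps)
    with gdvd[of i] s show ?thesis by simp
  qed
  have "x \<in> rat_points"
  proof -
    have "g * Gcd (range (\<lambda>i. x $ i)) dvd z i" for i
      unfolding zx by (metis Gcd_dvd dvd_mult2 mult.commute mult.left_commute mult_dvd_mono dvd_refl rangeI dvd_triv_right dvd_mult)
    then have "g * Gcd (range (\<lambda>i. x $ i)) dvd g"
      unfolding g_def by (intro Gcd_greatest) auto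
    then have "Gcd (range (\<lambda>i. x $ i)) = 1"
      using g0 Gcd_int_greater_eq_0[of "range (\<lambda>i. x $ i)"] by auto
    moreover have "0 \<le> x $ i" if "\<forall>j<i. x $ j = 0" for i
    proof -
      have "x $ k \<noteq> 0" using k zx[of k] by auto
      with that have "\<not> k < i" by blast
      then consider "i < k" | "i = k" by fastforce
      then show ?thesis
      proof cases
        case 1
        then show ?thesis by (simp add: x_def k)
      next
        case 2
        have "g > 0" using g0 by (simp add: g_def order.not_eq_order_implies_strict)
        moreover have "s * z k \<ge> 0" by (simp add: s_def sgn_if)
        moreover have "s * z k = g * x $ k" using zx[of k] s by (metis mult.assoc mult_1)
        ultimately show ?thesis using 2 by (metis zero_le_mult_iff not_le)
      qed
    qed
    ultimately show ?thesis by (simp add: rat_points_def)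
  qed
  moreover have "y $ i = (of_int (s * g) / of_int b) * of_int (x $ i)" for i
    using z[of i] zx[of i] b0 by (simp add: field_simps)
  moreover have "rat_of_int (s * g) / of_int b \<noteq> 0" using s g0 b0 by simp
  ultimately have ex: "x \<in> rat_points \<and> (\<exists>c. c \<noteq> 0 \<and> (\<forall>i. y $ i = c * of_int (x $ i)))" by blast
  have "u = v" if u: "u \<in> rat_points" "c \<noteq> 0" "\<And>i. y $ i = c * of_int (u $ i)"
    and v: "v \<in> rat_points" "e \<noteq> 0" "\<And>i. y $ i = e * of_int (v $ i)"
    for u v :: "(int, 'n) vec" and c e :: rat
  proof -
    obtain p q where pq: "quotient_of (c / e) = (p, q)" by fastforce
    have q: "q > 0" and ce: "c / e = of_int p / of_int q"
      using quotient_of_div[OF pq] quotient_of_denom_pos[OF pq] by auto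
    have uv: "p * u $ i = q * v $ i" for i
    proof -
      have "(c / e) * of_int (u $ i) = of_int (v $ i)"
        using u(3)[of i] v(2) v(3)[of i] by (simp add: field_simps)
      then have "rat_of_int (p * u $ i) = of_int (q * v $ i)"
        unfolding ce using q by (simp add: field_simps)
      then show ?thesis by (simp only: of_int_eq_iff)
    qed
    have "Gcd (range (\<lambda>i. p * u $ i)) = Gcd (range (\<lambda>i. q * v $ i))" by (simp add: uv)
    moreover have "Gcd (range (\<lambda>i. a * w $ i)) = \<bar>a\<bar>" if "w \<in> rat_points" for a :: int and w :: "(int, 'n) vec"
      using Gcd_mult[of a "range (\<lambda>i. w $ i)"] that
      by (simp add: rat_points_def image_image normalize_int_def)
    ultimately have "\<bar>p\<bar> = q" using u(1) v(1) q by simp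
    obtain k where k: "u $ k \<noteq> 0" "\<forall>j<k. u $ j = 0" using first nz[OF u(1)] by blast
    then have vk: "v $ k \<noteq> 0" "\<forall>j<k. v $ j = 0"
      using uv q \<open>\<bar>p\<bar> = q\<close> by (metis abs_0 less_irrefl mult_eq_0_iff)+
    have "u $ k > 0" "v $ k > 0"
      using k vk u(1) v(1) by (auto simp: rat_points_def order.not_eq_order_implies_strict)
    then have "p > 0" using uv[of k] q by (metis mult_pos_pos zero_less_mult_pos2)
    then show ?thesis using uv \<open>\<bar>p\<bar> = q\<close> by (auto simp: vec_eq_iff)
  qed
  with ex show ?thesis by blast
qed

lemma ln_abs_at_has_sum:
  assumes "a \<noteq> 0"
  shows "((\<lambda>v. ln (abs_at v a)) has_sum 0) rat_places"
proof -
  define n where "n = nat \<bar>a\<bar>"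
  have n: "n \<noteq> 0" using assms by (simp add: n_def)
  have mult: "multiplicity (int p) a = multiplicity p n" for p
  proof -
    have "int p ^ k dvd a \<longleftrightarrow> p ^ k dvd n" for k
      by (simp add: n_def flip: of_nat_power)
    then show ?thesis by (simp add: multiplicity_def n_def)
  qed
  have fin: "finite (Nonarchimedean ` prime_factors n)" by simp
  have "real n = (\<Prod>p\<in>prime_factors n. real p ^ multiplicity p n)"
    using prime_factorization_nat[of n] n by (metis (no_types, lifting) bot_nat_0.not_eq_extremum of_nat_power of_nat_prod prod.cong)
  then have "ln (real n) = (\<Sum>p\<in>prime_factors n. ln (real p ^ multiplicity p n))"
    by (simp only:, intro ln_prod) (auto simp: prime_gt_0_nat in_prime_factors_iff)
  also have "\<dots> = - (\<Sum>p\<in>prime_factors n. ln (abs_at (Nonarchimedean p) a))"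
    unfolding sum_negf[symmetric]
    by (rule sum.cong) (use assms in \<open>auto simp: mult ln_div in_prime_factors_iff prime_gt_0_nat\<close>)
  also have "(\<Sum>p\<in>prime_factors n. ln (abs_at (Nonarchimedean p) a)) =
      (\<Sum>v\<in>Nonarchimedean ` prime_factors n. ln (abs_at v a))"
    by (subst sum.reindex) (auto simp: inj_on_def)
  finally have "0 = (\<Sum>v\<in>insert Archimedean (Nonarchimedean ` prime_factors n). ln (abs_at v a))"
    using assms by (subst sum.insert[OF fin]) (auto simp: n_def)
  then show ?thesis
  proof (rule has_sum_finite_neutralI[rotated 3])
    fix v assume v: "v \<in> rat_places - insert Archimedean (Nonarchimedean ` prime_factors n)"
    then obtain p where p: "v = Nonarchimedean p" "prime p" "p \<notin> prime_factors n"
      by (auto simp: rat_places_def)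
    then have "multiplicity p n = 0"
      using n by (auto simp: in_prime_factors_iff not_dvd_imp_multiplicity_0)
    with p assms show "ln (abs_at v a) = 0" by (simp add: mult)
  qed (auto simp: rat_places_def in_prime_factors_iff)
qed

lemma max_abs_at_nonarchimedean:
  assumes "x \<in> rat_points" "prime p"
  shows "max_abs_at (Nonarchimedean p) x = 1"
proof -
  have G: "Gcd (range (\<lambda>i. x $ i)) = 1" using assms by (simp add: rat_points_def)
  have "\<not> int p dvd Gcd (range (\<lambda>i. x $ i))"
    using assms(2) G by (metis not_prime_unit prime_nat_int_transfer)
  then obtain i where i: "\<not> int p dvd x $ i" by (metis (no_types, lifting) Gcd_greatest rangeE)
  then have "abs_at (Nonarchimedean p) (x $ i) = 1"
    by (auto simp: not_dvd_imp_multiplicity_0)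
  moreover have "abs_at (Nonarchimedean p) b \<le> 1" for b
  proof -
    have "1 \<le> real p ^ k" for k
      using prime_gt_1_nat[OF assms(2)] by (intro one_le_power) auto
    then show ?thesis by (auto simp: divide_le_eq_1 intro: order_trans[OF zero_le_one])
  qed
  ultimately show ?thesis
    unfolding max_abs_at_def by (intro Max_eqI) (auto intro: image_eqI[of _ _ i] simp del: abs_at.simps)
qed

lemma local_height_nonneg:
  assumes "x \<in> rat_points" "prime p" "effective D"
  shows "0 \<le> local_height D (Nonarchimedean p) x"
proof -
  have "abs_at (Nonarchimedean p) b \<le> 1 \<and> 0 \<le> abs_at (Nonarchimedean p) b" for b
  proof -
    have "1 \<le> real p ^ k" for k
      using prime_gt_1_nat[OF assms(2)] by (intro one_le_power) auto
    then show ?thesis by (auto simp: divide_le_eq_1 intro: order_trans[OF zero_le_one])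
  qed
  then have "ln (abs_at (Nonarchimedean p) b) \<le> 0" for b
    by (metis ln_le_zero_iff ln_0 order_le_less order_refl)
  with assms show ?thesis
    unfolding local_height_def effective_def
    by (auto intro!: sum_nonneg mult_nonneg_nonneg mult_nonneg_nonpos
        simp: max_abs_at_nonarchimedean simp del: abs_at.simps)
qed

lemma peval_complex_coords: "peval of_int p (complex_coords x) = of_int (peval id p x)"
  by (simp add: peval_def complex_coords_def)

lemma weil_height_decomposition:
  fixes x :: "(int, 'n::{finite,linorder}) vec"
  assumes "x \<in> rat_points" and "complex_coords x \<notin> divisor_support D"
  shows "((\<lambda>v. local_height D v x) has_sum weil_height D x) rat_places"
proof -
  have x0: "complex_coords x \<noteq> 0"
  proof
    assume "complex_coords x = 0"
    then have "x $ i = 0" for i by (auto simp: complex_coords_def vec_eq_iff)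
    then show False using assms(1) by (auto simp: rat_points_def)
  qed
  have max_sum: "((\<lambda>v. ln (max_abs_at v x)) has_sum ln (max_abs_at Archimedean x)) rat_places"
    by (rule has_sum_finite_neutralI[of "{Archimedean}"])
      (auto simp: rat_places_def max_abs_at_nonarchimedean assms(1))
  have "((\<lambda>v. real_of_int (Poly_Mapping.lookup D p) *
       (real (total_degree p) * ln (max_abs_at v x) - ln (abs_at v (peval id p x)))) has_sum
      real_of_int (Poly_Mapping.lookup D p) *
       (real (total_degree p) * ln (max_abs_at Archimedean x) - 0)) rat_places"
    if p: "p \<in> Poly_Mapping.keys D" for p
  proof -
    have "peval id p x \<noteq> 0"
      using assms(2) x0 p by (auto simp: divisor_support_def form_locus_def peval_complex_coords)
    then show ?thesis
      using has_sum_cmult_right[OF has_sum_add[OF has_sum_cmult_right[OF max_sum]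
          has_sum_cmult_right[OF ln_abs_at_has_sum, where c = "-1"]]] by simp
  qed
  moreover have "((\<lambda>v. \<Sum>p\<in>K. g p v) has_sum (\<Sum>p\<in>K. s p)) A"
    if "finite K" "\<And>p. p \<in> K \<Longrightarrow> (g p has_sum s p) A"
    for K :: "('n, int) mvpoly set" and g :: "_ \<Rightarrow> _ \<Rightarrow> real" and s and A :: "place set"
    using that by (induction rule: finite_induct) (auto intro!: has_sum_add)
  ultimately have "((\<lambda>v. local_height D v x) has_sum (\<Sum>p\<in>Poly_Mapping.keys D.
      real_of_int (Poly_Mapping.lookup D p) *
       (real (total_degree p) * ln (max_abs_at Archimedean x) - 0))) rat_places"
    unfolding local_height_def by simp
  then show ?thesis
    by (simp add: weil_height_def divisor_degree_def sum_distrib_right mult.assoc)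
qed

end

theory Submission
  imports Defs "HOL-Real_Asymp.Real_Asymp"
begin

text \<open>
  Write \<open>h\<close> for the logarithmic height and \<open>x\<^sub>n = f\<^sup>n(P)\<close>. If \<open>F(x\<^sub>n)\<close> has no primitive prime divisor,
  then every prime dividing it divides an earlier \<open>F(x\<^sub>m) \<noteq> 0\<close>, so the truncated counting function of
  \<open>F = 0\<close> at \<open>x\<^sub>n\<close> is at most \<open>\<Sum>m<n. deg F * h(x\<^sub>m) + O(1)\<close>. Since \<open>h(f(x)) \<ge> d h(x) - O(1)\<close>, this sum is
  at most \<open>deg F / (d - 1) * h(x\<^sub>n) + O(n)\<close>. Outside a proper closed subset, Vojta's conjecture bounds
  the counting function from below by \<open>(deg F - (N + 1) - \<epsilon>) h(x\<^sub>n)\<close>. The hypothesis on \<open>deg F\<close> says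
  that the second coefficient is the larger one, so \<open>h(x\<^sub>n) = O(n)\<close>, whereas the height grows
  exponentially along an infinite orbit.

  The lower bound for \<open>h(f(x))\<close> rests on the Nullstellensatz: the forms defining \<open>f\<close> have no common
  zero, so a power of each coordinate is a combination of them with rational coefficients.
\<close>

text \<open>The hypothesis on \<open>f\<close> concerns complex zeros, so the Nullstellensatz is
  applied over the complex numbers, whereas the height estimate needs rational coefficients with a
  common denominator. A rational-linear map from the complex to the rational numbers that fixes 1,
  applied to the coefficients, bridges the gap at rational points. The identity is taken on the
  chart X_j = 1, where it says that 1 lies in the ideal of the f_i and X_j - 1; it is then evaluated
  at x / x_j. Vojta's conjecture speaks of formal sums of prime forms, so F has to be split into
  distinct prime forms over the integers. That the factors of a form are again forms is seen by
  adjoining a variable that records the degree. Non-density is carried along as the vanishing of one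
  nonzero rational form, a property stable under finite unions. The closed set of the conjecture,
  the zeros of F, the finitely many exceptions and an initial segment of the orbit are all absorbed
  in this way.\<close>

no_notation fps_nth (infixl \<open>$\<close> 75)

section \<open>Evaluation of polynomials\<close>

lemma mvpoly_eq_sum_single:
  "p = (\<Sum>m\<in>Poly_Mapping.keys p. Poly_Mapping.single m (Poly_Mapping.lookup p m))"
proof (rule poly_mapping_eqI)
  fix k
  have "Poly_Mapping.lookup (\<Sum>m\<in>Poly_Mapping.keys p. Poly_Mapping.single m (Poly_Mapping.lookup p m)) k
      = (\<Sum>m\<in>Poly_Mapping.keys p. if m = k then Poly_Mapping.lookup p m else 0)"
    by (auto simp: lookup_sum lookup_single when_def intro!: sum.cong)
  also have "\<dots> = Poly_Mapping.lookup p k" by (simp add: in_keys_iff)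
  finally show "Poly_Mapping.lookup p k = Poly_Mapping.lookup
    (\<Sum>m\<in>Poly_Mapping.keys p. Poly_Mapping.single m (Poly_Mapping.lookup p m)) k" ..
qed

definition monomial_value :: "('n::finite \<Rightarrow>\<^sub>0 nat) \<Rightarrow> 'a::comm_semiring_1^'n \<Rightarrow> 'a" where
  "monomial_value m x = (\<Prod>i\<in>UNIV. (x $ i) ^ Poly_Mapping.lookup m i)"

lemma monomial_value_add: "monomial_value (m + l) x = monomial_value m x * monomial_value l x"
  by (simp add: monomial_value_def lookup_add power_add prod.distrib)

lemma monomial_value_0 [simp]: "monomial_value 0 x = 1"
  by (simp add: monomial_value_def)

lemma monomial_value_single: "monomial_value (Poly_Mapping.single i k) x = (x $ i) ^ k"
proof -
  have "monomial_value (Poly_Mapping.single i k) x = (\<Prod>j\<in>UNIV. if j = i then (x $ i) ^ k else 1)"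
    unfolding monomial_value_def by (intro prod.cong) (auto simp: lookup_single when_def)
  then show ?thesis by simp
qed

lemma monomial_value_scale: "monomial_value m (t *s x) = t ^ mdeg m * monomial_value m x"
  by (simp add: monomial_value_def mdeg_def power_mult_distrib prod.distrib power_sum)

lemma peval_monomial_value:
  "peval \<phi> p x = (\<Sum>m\<in>Poly_Mapping.keys p. \<phi> (Poly_Mapping.lookup p m) * monomial_value m x)"
  by (simp add: peval_def monomial_value_def)

lemma peval_superset:
  assumes "finite M" "Poly_Mapping.keys p \<subseteq> M" "\<phi> 0 = 0"
  shows "peval \<phi> p x = (\<Sum>m\<in>M. \<phi> (Poly_Mapping.lookup p m) * monomial_value m x)"
  unfolding peval_monomial_value using assms
  by (intro sum.mono_neutral_left) (auto simp: in_keys_iff)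

lemma mdeg_0 [simp]: "mdeg 0 = 0"
  by (simp add: mdeg_def)

lemma mdeg_add: "mdeg (m + l) = mdeg m + mdeg l"
  by (simp add: mdeg_def lookup_add sum.distrib)

lemma mdeg_single [simp]: "mdeg (Poly_Mapping.single i k) = k"
proof -
  have "mdeg (Poly_Mapping.single i k) = (\<Sum>j\<in>UNIV. if j = i then k else 0)"
    unfolding mdeg_def by (intro sum.cong) (auto simp: lookup_single when_def)
  then show ?thesis by simp
qed

lemma mdeg_eq_0_iff: "mdeg m = 0 \<longleftrightarrow> m = 0"
  by (auto simp: mdeg_def intro!: poly_mapping_eqI)

lemma sum_single_lookup: "(\<Sum>i\<in>UNIV. Poly_Mapping.single i (Poly_Mapping.lookup m i)) = m"
  for m :: "'n::finite \<Rightarrow>\<^sub>0 nat"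
proof (rule poly_mapping_eqI)
  fix k
  have "Poly_Mapping.lookup (\<Sum>i\<in>UNIV. Poly_Mapping.single i (Poly_Mapping.lookup m i)) k
      = (\<Sum>i\<in>UNIV. if i = k then Poly_Mapping.lookup m i else 0)"
    by (auto simp: lookup_sum lookup_single when_def intro!: sum.cong)
  then show "Poly_Mapping.lookup (\<Sum>i\<in>UNIV. Poly_Mapping.single i (Poly_Mapping.lookup m i)) k
      = Poly_Mapping.lookup m k" by simp
qed

text \<open>Evaluation at the vector of variables reproduces a polynomial. This transfers rules for
  products of values, such as congruences modulo an ideal and the extraction of powers of t, to
  monomials of the ring itself.\<close>

lemma monomial_value_variables:
  "monomial_value m (\<chi> i. Poly_Mapping.single (Poly_Mapping.single i 1) 1) =
    (Poly_Mapping.single m 1 :: ('n::finite, 'b::comm_ring_1) mvpoly)"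
proof -
  have pow: "Poly_Mapping.single (Poly_Mapping.single i 1) (1::'b) ^ k =
      Poly_Mapping.single (Poly_Mapping.single i k) 1" for i :: 'n and k
    by (induction k) (auto simp: mult_single simp flip: single_add)
  have prod: "(\<Prod>i\<in>A. Poly_Mapping.single (a i) (1::'b)) = Poly_Mapping.single (\<Sum>i\<in>A. a i) 1"
    for A :: "'n set" and a :: "'n \<Rightarrow> 'n \<Rightarrow>\<^sub>0 nat"
    by (induction A rule: infinite_finite_induct) (auto simp: mult_single)
  show ?thesis
    unfolding monomial_value_def by (simp add: pow[unfolded One_nat_def] prod sum_single_lookup)
qed

text \<open>One set of rules serves all coefficient maps in use: \<open>id\<close>,
  \<open>of_int\<close>, \<open>of_rat\<close>, and the embeddings of constants into polynomial
  rings.\<close>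

locale coeff_hom =
  fixes \<phi> :: "'b::comm_ring_1 \<Rightarrow> 'a::comm_ring_1"
  assumes hom_add: "\<phi> (a + b) = \<phi> a + \<phi> b"
    and hom_mult: "\<phi> (a * b) = \<phi> a * \<phi> b"
    and hom_1: "\<phi> 1 = 1"
begin

lemma hom_0: "\<phi> 0 = 0"
  using hom_add[of 0 0] by simp

lemma peval_0 [simp]: "peval \<phi> 0 x = 0"
  by (simp add: peval_def)

lemma peval_add: "peval \<phi> (p + q) x = peval \<phi> p x + peval \<phi> q x"
proof -
  let ?M = "Poly_Mapping.keys p \<union> Poly_Mapping.keys q"
  have "peval \<phi> r x = (\<Sum>m\<in>?M. \<phi> (Poly_Mapping.lookup r m) * monomial_value m x)"
    if "Poly_Mapping.keys r \<subseteq> ?M" for r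
    using that by (intro peval_superset) (auto simp: hom_0)
  then show ?thesis
    using keys_add[of p q]
    by (simp add: lookup_add hom_add distrib_right sum.distrib)
qed

lemma peval_sum: "peval \<phi> (\<Sum>a\<in>A. p a) x = (\<Sum>a\<in>A. peval \<phi> (p a) x)"
  by (induction A rule: infinite_finite_induct) (auto simp: peval_add)

lemma peval_single: "peval \<phi> (Poly_Mapping.single m c) x = \<phi> c * monomial_value m x"
  by (subst peval_superset[of "{m}"]) (auto simp: hom_0)

lemma peval_mult: "peval \<phi> (p * q) x = peval \<phi> p x * peval \<phi> q x"
proof -
  let ?s = "\<lambda>p m. Poly_Mapping.single m (Poly_Mapping.lookup p m)"
  have "p * q = (\<Sum>m\<in>Poly_Mapping.keys p. \<Sum>l\<in>Poly_Mapping.keys q. ?s p m * ?s q l)"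
    by (subst mvpoly_eq_sum_single[of p], subst mvpoly_eq_sum_single[of q]) (simp add: sum_product)
  then have "peval \<phi> (p * q) x = (\<Sum>m\<in>Poly_Mapping.keys p. \<Sum>l\<in>Poly_Mapping.keys q.
      (\<phi> (Poly_Mapping.lookup p m) * monomial_value m x) * (\<phi> (Poly_Mapping.lookup q l) * monomial_value l x))"
    by (simp add: peval_sum mult_single peval_single hom_mult monomial_value_add ac_simps)
  also have "\<dots> = peval \<phi> p x * peval \<phi> q x"
    by (simp add: peval_monomial_value sum_product)
  finally show ?thesis .
qed

lemma peval_1 [simp]: "peval \<phi> 1 x = 1"
  using peval_single[of 0 1 x] by (simp add: hom_1 del: single_one flip: single_one)

lemma peval_uminus: "peval \<phi> (- p) x = - peval \<phi> p x"
  using peval_add[of p "- p" x] by (simp add: eq_neg_iff_add_eq_0 add.commute)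

lemma peval_diff: "peval \<phi> (p - q) x = peval \<phi> p x - peval \<phi> q x"
  using peval_add[of p "- q" x] by (simp add: peval_uminus)

lemma peval_prod: "peval \<phi> (\<Prod>a\<in>A. p a) x = (\<Prod>a\<in>A. peval \<phi> (p a) x)"
  by (induction A rule: infinite_finite_induct) (auto simp: peval_mult)

lemma peval_variable: "peval \<phi> (Poly_Mapping.single (Poly_Mapping.single i 1) 1) x = x $ i"
  by (simp add: peval_single hom_1 monomial_value_single)

lemma peval_const: "peval \<phi> (Poly_Mapping.single 0 c) x = \<phi> c"
  by (simp add: peval_single)

lemma peval_homogeneous: "homogeneous d p \<Longrightarrow> peval \<phi> p (t *s x) = t ^ d * peval \<phi> p x"
  by (auto simp: homogeneous_def peval_monomial_value monomial_value_scale sum_distrib_left ac_simps intro!: sum.cong)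

end

lemma coeff_hom_id: "coeff_hom id" by unfold_locales auto
lemma coeff_hom_of_int: "coeff_hom of_int" by unfold_locales auto
lemma coeff_hom_of_rat: "coeff_hom (of_rat :: rat \<Rightarrow> 'a::field_char_0)"
  by unfold_locales (auto simp: of_rat_add of_rat_mult)

interpretation peval_id: coeff_hom id by (rule coeff_hom_id)
interpretation peval_of_int: coeff_hom of_int by (rule coeff_hom_of_int)
interpretation peval_of_rat: coeff_hom "of_rat :: rat \<Rightarrow> 'a::field_char_0" by (rule coeff_hom_of_rat)

lemma peval_mvar: "peval of_int (mvar i) x = (x $ i :: 'a::comm_ring_1)"
  unfolding mvar_def by (rule peval_of_int.peval_variable)

section \<open>Homogeneous polynomials and their degrees\<close>

lemma homogeneous_add: "homogeneous d p \<Longrightarrow> homogeneous d q \<Longrightarrow> homogeneous d (p + q)"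
  unfolding homogeneous_def using keys_add[of p q] by blast

lemma homogeneous_mult: "homogeneous d p \<Longrightarrow> homogeneous e q \<Longrightarrow> homogeneous (d + e) (p * q)"
  unfolding homogeneous_def using keys_mult[of p q] by (fastforce simp: mdeg_add)

lemma homogeneous_single [simp]: "homogeneous (mdeg m) (Poly_Mapping.single m c)"
  by (simp add: homogeneous_def)

lemma homogeneous_mvar: "homogeneous 1 (mvar i)"
  by (simp add: homogeneous_def mvar_def)

lemma homogeneous_1: "homogeneous 0 (1 :: ('n::finite, 'b::comm_ring_1) mvpoly)"
  by (simp add: homogeneous_def)

lemma homogeneous_prod:
  "(\<And>a. a \<in> A \<Longrightarrow> homogeneous (d a) (p a)) \<Longrightarrow>
    homogeneous (\<Sum>a\<in>A. d a) (\<Prod>a\<in>A. p a :: ('n::finite, 'b::comm_ring_1) mvpoly)"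
  by (induction A rule: infinite_finite_induct) (auto intro: homogeneous_mult homogeneous_1)

lemma total_degree_homogeneous:
  assumes "homogeneous d p" "p \<noteq> 0"
  shows "total_degree p = d"
proof -
  have "Poly_Mapping.keys p \<noteq> {}"
    using assms(2) by (metis empty_iff in_keys_iff lookup_zero poly_mapping_eqI)
  then obtain m where "m \<in> Poly_Mapping.keys p" by blast
  then have "mdeg ` Poly_Mapping.keys p = {d}"
    using assms(1) by (force simp: homogeneous_def)
  then show ?thesis by (simp add: total_degree_def)
qed

section \<open>The weak Nullstellensatz over the complex numbers\<close>

lemma map_poly_hom_add:
  assumes "coeff_hom h"
  shows "poly (map_poly h (p + q)) x = poly (map_poly h p) x + poly (map_poly h q) x"
proof -
  interpret coeff_hom h by fact
  show ?thesis
    by (induction p q rule: poly_induct2) (auto simp: map_poly_pCons hom_0 hom_add algebra_simps)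
qed

lemma map_poly_hom_mult:
  assumes "coeff_hom h"
  shows "poly (map_poly h (p * q)) x = poly (map_poly h p) x * poly (map_poly h q) x"
proof -
  interpret coeff_hom h by fact
  have smult: "poly (map_poly h (smult a q)) x = h a * poly (map_poly h q) x" for a q
    by (induction q) (auto simp: map_poly_pCons hom_0 hom_mult algebra_simps)
  show ?thesis
    by (induction p) (auto simp: map_poly_pCons hom_0 map_poly_hom_add[OF assms] smult algebra_simps)
qed

section \<open>Ideals and congruences modulo an ideal\<close>

definition ring_ideal :: "'a::comm_ring_1 set \<Rightarrow> bool" where
  "ring_ideal I \<longleftrightarrow> 0 \<in> I \<and> (\<forall>a\<in>I. \<forall>b\<in>I. a + b \<in> I) \<and> (\<forall>a\<in>I. \<forall>r. r * a \<in> I)"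

lemma ring_ideal_0: "ring_ideal I \<Longrightarrow> 0 \<in> I"
  and ring_ideal_add: "ring_ideal I \<Longrightarrow> a \<in> I \<Longrightarrow> b \<in> I \<Longrightarrow> a + b \<in> I"
  and ring_ideal_mult: "ring_ideal I \<Longrightarrow> a \<in> I \<Longrightarrow> r * a \<in> I"
  by (auto simp: ring_ideal_def)

lemma ring_ideal_diff: "ring_ideal I \<Longrightarrow> a \<in> I \<Longrightarrow> b \<in> I \<Longrightarrow> a - b \<in> I"
  using ring_ideal_add[of I a "- 1 * b"] ring_ideal_mult[of I b "-1"] by simp

lemma ring_ideal_sum: "ring_ideal I \<Longrightarrow> (\<And>a. a \<in> A \<Longrightarrow> p a \<in> I) \<Longrightarrow> sum p A \<in> I"
  by (induction A rule: infinite_finite_induct) (auto intro: ring_ideal_0 ring_ideal_add)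

lemma ring_ideal_cong_mult:
  assumes "ring_ideal I" "a - b \<in> I" "c - d \<in> I"
  shows "a * c - b * d \<in> I"
  using ring_ideal_add[OF assms(1) ring_ideal_mult[OF assms(1,2), of c] ring_ideal_mult[OF assms(1,3), of b]]
  by (simp add: algebra_simps)

lemma ring_ideal_cong_prod:
  assumes "ring_ideal I" "\<And>i. i \<in> A \<Longrightarrow> a i - b i \<in> I"
  shows "prod a A - prod b A \<in> I"
  using assms(2)
  by (induction A rule: infinite_finite_induct)
    (auto intro: ring_ideal_cong_mult assms(1) simp: ring_ideal_0[OF assms(1)])

lemma ring_ideal_cong_power:
  assumes "ring_ideal I" "a - b \<in> I"
  shows "a ^ k - b ^ k \<in> I"
  by (induction k) (auto intro: ring_ideal_cong_mult assms simp: ring_ideal_0[OF assms(1)])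

abbreviation mconst :: "'b::zero \<Rightarrow> ('n, 'b) mvpoly" where
  "mconst c \<equiv> Poly_Mapping.single 0 c"

lemma coeff_hom_mconst: "coeff_hom (mconst :: 'b::comm_ring_1 \<Rightarrow> ('n, 'b) mvpoly)"
  by unfold_locales (auto simp: single_add mult_single)

interpretation mvpoly_space: vector_space "\<lambda>(c::complex) (p :: ('n, complex) mvpoly). mconst c * p"
  by unfold_locales (auto simp: algebra_simps single_add mult_single)

lemma finite_mdeg_le: "finite {m :: 'n::finite \<Rightarrow>\<^sub>0 nat. mdeg m \<le> D}"
proof -
  have "finite ({f. \<forall>i. f i \<in> {..D}} :: ('n \<Rightarrow> nat) set)"
    using finite_set_of_finite_funs[of "UNIV :: 'n set" "{..D}"] by simp
  moreover have "Poly_Mapping.lookup ` {m :: 'n \<Rightarrow>\<^sub>0 nat. mdeg m \<le> D} \<subseteq> {f. \<forall>i. f i \<in> {..D}}"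
  proof clarsimp
    fix m :: "'n \<Rightarrow>\<^sub>0 nat" and i assume "mdeg m \<le> D"
    moreover have "Poly_Mapping.lookup m i \<le> mdeg m"
      unfolding mdeg_def by (rule member_le_sum) auto
    ultimately show "Poly_Mapping.lookup m i \<le> D" by simp
  qed
  ultimately show ?thesis
    by (meson finite_imageD finite_subset inj_onI poly_mapping.lookup_inject)
qed

text \<open>
  If \<open>X - c\<close> were invertible modulo \<open>I\<close> for every \<open>c\<close>, the uncountably many inverses could not be
  linearly independent, as the ring has countable dimension over \<open>\<complex>\<close>. Clearing denominators in a
  linear relation gives a nonzero univariate polynomial in \<open>X\<close> that lies in \<open>I\<close> although it is a
  product of invertible linear factors.
\<close>

lemma ring_ideal_extend_root:
  fixes I :: "('n::finite, complex) mvpoly set" and X :: "('n, complex) mvpoly"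
  assumes I: "ring_ideal I" "1 \<notin> I"
  shows "\<exists>c. \<forall>q. (X - mconst c) * q - 1 \<notin> I"
proof (rule ccontr)
  assume "\<not> ?thesis"
  then obtain q where q: "\<And>c. (X - mconst c) * q c - 1 \<in> I" by metis
  \<comment> \<open>If q a = q b with a and b distinct, the difference of the two congruences puts
    (a - b) q a into I, hence q a, hence 1.\<close>
  have "inj q"
  proof (rule injI, rule ccontr)
    fix a b assume ab: "q a = q b" "a \<noteq> b"
    have "mconst (a - b) * q a \<in> I"
      using ring_ideal_diff[OF I(1) q[of b] q[of a]] ab by (simp add: algebra_simps single_diff)
    then have "mconst (inverse (a - b)) * (mconst (a - b) * q a) \<in> I"
      by (rule ring_ideal_mult[OF I(1)])
    then have "q a \<in> I" using ab by (simp add: mult_single flip: mult.assoc)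
    then have "(X - mconst a) * q a \<in> I" by (rule ring_ideal_mult[OF I(1)])
    from ring_ideal_diff[OF I(1) this q[of a]] show False using I(2) by simp
  qed
  \<comment> \<open>Uncountably many c are distributed over countably many degree bounds, so some
    \<open>A D\<close> is infinite: infinitely many inverses lie in one finite-dimensional
    space.\<close>
  define A where "A D = {c. \<forall>m\<in>Poly_Mapping.keys (q c). mdeg m \<le> D}" for D
  have "\<exists>D. c \<in> A D" for c
    unfolding A_def using finite_nat_set_iff_bounded_le[of "mdeg ` Poly_Mapping.keys (q c)"] by auto
  then have "(\<Union>D. A D) = UNIV" by blast
  moreover have "uncountable (UNIV :: complex set)"
    by (rule uncountable_UNIV_complex)
  ultimately have "\<not> (\<forall>D. countable (A D))"
    by (metis countable_UN countableI_type)
  then obtain D where D: "infinite (A D)" using uncountable_infinite by blast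
  define B where "B = (\<lambda>m. Poly_Mapping.single m (1::complex)) ` {m :: 'n \<Rightarrow>\<^sub>0 nat. mdeg m \<le> D}"
  have "finite B" by (simp add: B_def finite_mdeg_le)
  have "q ` A D \<subseteq> mvpoly_space.span B"
  proof (rule image_subsetI)
    fix c assume c: "c \<in> A D"
    have "q c = (\<Sum>m\<in>Poly_Mapping.keys (q c). mconst (Poly_Mapping.lookup (q c) m) * Poly_Mapping.single m 1)"
      by (subst mvpoly_eq_sum_single) (simp add: mult_single)
    also have "\<dots> \<in> mvpoly_space.span B"
      using c by (intro mvpoly_space.span_sum mvpoly_space.span_scale mvpoly_space.span_base)
        (auto simp: A_def B_def)
    finally show "q c \<in> mvpoly_space.span B" .
  qed
  moreover have "infinite (q ` A D)" using D \<open>inj q\<close> by (meson finite_imageD inj_on_subset subset_UNIV)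
  ultimately have "mvpoly_space.dependent (q ` A D)"
    using mvpoly_space.independent_span_bound[OF \<open>finite B\<close>] by blast
  then obtain T' u v where T': "finite T'" "T' \<subseteq> q ` A D" "(\<Sum>v\<in>T'. mconst (u v) * v) = 0"
      and v: "v \<in> T'" "u v \<noteq> 0"
    unfolding mvpoly_space.dependent_explicit by blast
  then obtain T where T: "finite T" "T' = q ` T" by (metis finite_subset_image)
  have rel: "(\<Sum>c\<in>T. mconst (u (q c)) * q c) = 0"
    using T' T \<open>inj q\<close> by (simp add: sum.reindex[OF inj_on_subset[OF \<open>inj q\<close>]])
  obtain c0 where c0: "c0 \<in> T" "u (q c0) \<noteq> 0" using v T by auto
  \<comment> \<open>\<open>h\<close> is the ring homomorphism that substitutes X into a univariate
    polynomial.\<close>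
  define h where "h p = poly (map_poly mconst p) X" for p :: "complex poly"
  have h_mult: "h (p * p') = h p * h p'" and h_add: "h (p + p') = h p + h p'" for p p'
    by (simp_all add: h_def map_poly_hom_mult[OF coeff_hom_mconst] map_poly_hom_add[OF coeff_hom_mconst])
  have h_const: "h [:c:] = mconst c" and h_lin: "h [:-c, 1:] = X - mconst c" for c
    by (simp_all add: h_def map_poly_pCons single_uminus)
  have h_sum: "h (\<Sum>c\<in>S. p c) = (\<Sum>c\<in>S. h (p c))" for S and p :: "complex \<Rightarrow> complex poly"
    using h_const[of 0] by (induction S rule: infinite_finite_induct) (auto simp: h_add)
  have h_prod: "h (\<Prod>c\<in>S. p c) = (\<Prod>c\<in>S. h (p c))" for S and p :: "complex \<Rightarrow> complex poly"
    using h_const[of 1] by (induction S rule: infinite_finite_induct) (auto simp: h_mult one_pCons)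
  \<comment> \<open>The numerator of the sum of u(q c) / (t - c) over the common denominator. At c0
    only the summand of c0 survives, so g is nonzero.\<close>
  define g where "g = (\<Sum>c\<in>T. [:u (q c):] * (\<Prod>b\<in>T - {c}. [:-b, 1:]))"
  have "poly g c0 = (\<Sum>c\<in>T. if c = c0 then u (q c0) * (\<Prod>b\<in>T - {c0}. c0 - b) else 0)"
    unfolding g_def poly_sum using c0 T by (intro sum.cong) (auto simp: poly_prod)
  also have "\<dots> \<noteq> 0" using c0 T by simp
  finally have "g \<noteq> 0" by auto
  \<comment> \<open>Modulo I, the product without the factor of c is the full product times q c.
    Hence h g is congruent to the full product times the linear relation, which is 0.\<close>
  have "h g \<in> I"
  proof -
    let ?P = "\<Prod>b\<in>T. X - mconst b"
    have "mconst (u (q c)) * (\<Prod>b\<in>T - {c}. X - mconst b) - ?P * (mconst (u (q c)) * q c) \<in> I"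
      if "c \<in> T" for c
    proof -
      let ?Q = "\<Prod>b\<in>T - {c}. X - mconst b"
      have P: "?P = (X - mconst c) * ?Q"
        by (rule prod.remove[OF T(1) that])
      have "mconst (u (q c)) * ?Q - ?P * (mconst (u (q c)) * q c)
          = (- mconst (u (q c)) * ?Q) * ((X - mconst c) * q c - 1)"
        unfolding P by (simp add: algebra_simps)
      then show ?thesis using ring_ideal_mult[OF I(1) q[of c]] by metis
    qed
    then have "(\<Sum>c\<in>T. mconst (u (q c)) * (\<Prod>b\<in>T - {c}. X - mconst b) - ?P * (mconst (u (q c)) * q c)) \<in> I"
      by (rule ring_ideal_sum[OF I(1)])
    moreover have "h g = (\<Sum>c\<in>T. mconst (u (q c)) * (\<Prod>b\<in>T - {c}. X - mconst b))"
      by (simp only: g_def h_sum h_mult h_prod h_const h_lin)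
    ultimately show ?thesis
      using rel by (simp add: sum_subtractf flip: sum_distrib_left)
  qed
  \<comment> \<open>Over the complex numbers p splits into linear factors, each of which has an
    inverse modulo I by the choice of q.\<close>
  have inv: "\<exists>s. h p * s - 1 \<in> I" if "p \<noteq> 0" for p
    using that
  proof (induction "degree p" arbitrary: p)
    case 0
    then obtain a where "p = [:a:]" "a \<noteq> 0" by (metis degree_eq_zeroE pCons_0_0)
    then have "h p * mconst (inverse a) = 1" by (simp add: h_const mult_single)
    then show ?case by (metis I(1) diff_self ring_ideal_0)
  next
    case (Suc k)
    then have "\<not> constant (poly p)" by (simp add: constant_degree)
    then obtain r where "poly p r = 0" using fundamental_theorem_of_algebra by blast
    then obtain p' where p': "p = [:-r, 1:] * p'" by (auto simp: poly_eq_0_iff_dvd)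
    with Suc.prems have "p' \<noteq> 0" by auto
    then have "degree p = degree [:-r, 1:] + degree p'" unfolding p' by (intro degree_mult_eq) auto
    then have "k = degree p'" using Suc.hyps(2) by simp
    with Suc.hyps(1) \<open>p' \<noteq> 0\<close> obtain s where s: "h p' * s - 1 \<in> I" by blast
    have "((X - mconst r) * q r) * (h p' * s) - 1 * 1 \<in> I"
      by (intro ring_ideal_cong_mult I q s)
    then have "h p * (q r * s) - 1 \<in> I" by (simp only: p' h_mult h_lin mult_1 ac_simps)
    then show ?case by blast
  qed
  obtain s where s: "h g * s - 1 \<in> I" using inv[OF \<open>g \<noteq> 0\<close>] by blast
  have "h g * s \<in> I" using ring_ideal_mult[OF I(1) \<open>h g \<in> I\<close>, of s] by (simp add: mult.commute)
  from ring_ideal_diff[OF I(1) this s] have "h g * s - (h g * s - 1) \<in> I" .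
  with I(2) show False by simp
qed

text \<open>Each step adjoins one X i - c to a proper ideal, with c chosen so that X i - c is not
  invertible modulo it. Applied to the finitely many variables, this yields an ideal modulo which
  every variable is a constant, as for a maximal ideal.\<close>

lemma ring_ideal_extend_roots:
  fixes I :: "('n::finite, complex) mvpoly set" and X :: "'i \<Rightarrow> ('n, complex) mvpoly"
  assumes "finite A" and I: "ring_ideal I" "1 \<notin> I"
  shows "\<exists>J z. ring_ideal J \<and> 1 \<notin> J \<and> I \<subseteq> J \<and> (\<forall>i\<in>A. X i - mconst (z i) \<in> J)"
  using assms(1)
proof (induction A rule: finite_induct)
  case empty
  show ?case using I by blast
next
  case (insert i A)
  then obtain J z where J: "ring_ideal J" "1 \<notin> J" "I \<subseteq> J" "\<And>i. i \<in> A \<Longrightarrow> X i - mconst (z i) \<in> J"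
    by blast
  from ring_ideal_extend_root[OF J(1,2)] obtain c where c: "\<And>q. (X i - mconst c) * q - 1 \<notin> J" by blast
  \<comment> \<open>The ideal generated by J and X i - c. If it contained 1, then X i - c would be
    invertible modulo J, against the choice of c.\<close>
  define K where "K = {a + r * (X i - mconst c) | a r. a \<in> J}"
  have KI: "a + r * (X i - mconst c) \<in> K" if "a \<in> J" for a r using that by (auto simp: K_def)
  have "J \<subseteq> K" using KI[of _ 0] by auto
  have "ring_ideal K"
    unfolding ring_ideal_def
  proof (intro conjI ballI allI)
    show "0 \<in> K" using \<open>J \<subseteq> K\<close> ring_ideal_0[OF J(1)] by blast
  next
    fix a b assume "a \<in> K" "b \<in> K"
    then obtain a' r b' s where ab: "a = a' + r * (X i - mconst c)" "b = b' + s * (X i - mconst c)"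
      and "a' \<in> J" "b' \<in> J"
      unfolding K_def by blast
    moreover have "a + b = (a' + b') + (r + s) * (X i - mconst c)" unfolding ab by (simp add: algebra_simps)
    ultimately show "a + b \<in> K" using J(1) by (simp only:, intro KI ring_ideal_add)
  next
    fix a t assume "a \<in> K"
    then obtain a' r where a: "a = a' + r * (X i - mconst c)" and "a' \<in> J" unfolding K_def by blast
    moreover have "t * a = t * a' + (t * r) * (X i - mconst c)" unfolding a by (simp add: algebra_simps)
    ultimately show "t * a \<in> K" using J(1) by (simp only:, intro KI ring_ideal_mult)
  qed
  moreover have "1 \<notin> K"
  proof
    assume "1 \<in> K"
    then obtain a r where ar: "1 = a + r * (X i - mconst c)" "a \<in> J" unfolding K_def by blast
    then have "(X i - mconst c) * r - 1 = - 1 * a" by (simp add: algebra_simps)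
    with c[of r] ring_ideal_mult[OF J(1) ar(2), of "- 1"] show False by simp
  qed
  moreover have "X i - mconst c \<in> K" using KI[OF ring_ideal_0[OF J(1)], of 1] by simp
  ultimately show ?case
    using J \<open>J \<subseteq> K\<close> insert.hyps
    by (intro exI[of _ K] exI[of _ "z(i := c)"]) auto
qed

text \<open>A proper I would extend to a proper J with X_i congruent to z_i for all i. Every p is
  then congruent to the constant p(z), so a p in I with p(z) nonzero puts a unit into J.\<close>

theorem weak_nullstellensatz:
  fixes I :: "('n::finite, complex) mvpoly set"
  assumes I: "ring_ideal I" and no_zero: "\<And>z. \<exists>p\<in>I. peval id p z \<noteq> 0"
  shows "1 \<in> I"
proof (rule ccontr)
  assume "1 \<notin> I"
  let ?X = "\<lambda>i. Poly_Mapping.single (Poly_Mapping.single i 1) 1 :: ('n, complex) mvpoly"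
  obtain J z where J: "ring_ideal J" "1 \<notin> J" "I \<subseteq> J" and z: "\<And>i. ?X i - mconst (z i) \<in> J"
    using ring_ideal_extend_roots[OF finite I \<open>1 \<notin> I\<close>, of UNIV ?X] by blast
  interpret mconst: coeff_hom "mconst :: complex \<Rightarrow> ('n, complex) mvpoly" by (rule coeff_hom_mconst)
  let ?z = "\<chi> i. z i"
  have mconst_sum: "mconst (sum t A) = (\<Sum>a\<in>A. mconst (t a) :: ('n, complex) mvpoly)" for t :: "_ \<Rightarrow> complex" and A
    by (induction A rule: infinite_finite_induct) (auto simp: single_add)
  have mconst_prod: "mconst (prod t A) = (\<Prod>a\<in>A. mconst (t a) :: ('n, complex) mvpoly)" for t :: "'n \<Rightarrow> complex" and A
    by (induction A rule: infinite_finite_induct) (auto simp: mconst.hom_mult)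
  have mconst_power: "mconst (a ^ k) = (mconst a ^ k :: ('n, complex) mvpoly)" for a :: complex and k
    by (induction k) (auto simp: mconst.hom_mult)
  have mono: "Poly_Mapping.single m 1 - mconst (monomial_value m ?z) \<in> J" for m
  proof -
    have "(\<Prod>i\<in>UNIV. ?X i ^ Poly_Mapping.lookup m i) - (\<Prod>i\<in>UNIV. mconst (z i) ^ Poly_Mapping.lookup m i) \<in> J"
      by (intro ring_ideal_cong_prod ring_ideal_cong_power J z)
    then show ?thesis
      using monomial_value_variables[of m, where 'b = complex]
      by (simp add: monomial_value_def mconst_prod mconst_power)
  qed
  have "p - mconst (peval id p ?z) \<in> J" for p
  proof -
    have "(\<Sum>m\<in>Poly_Mapping.keys p. mconst (Poly_Mapping.lookup p m) *
        (Poly_Mapping.single m 1 - mconst (monomial_value m ?z))) \<in> J"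
      by (intro ring_ideal_sum ring_ideal_mult J mono)
    then show ?thesis
      by (subst (asm) right_diff_distrib)
        (simp add: sum_subtractf mult_single peval_monomial_value mconst_sum flip: mvpoly_eq_sum_single)
  qed
  moreover obtain p where p: "p \<in> I" "peval id p ?z \<noteq> 0" using no_zero by blast
  ultimately have "p - (p - mconst (peval id p ?z)) \<in> J" using J by (blast intro: ring_ideal_diff)
  then have "mconst (peval id p ?z) \<in> J" by simp
  then have "mconst (inverse (peval id p ?z)) * mconst (peval id p ?z) \<in> J" by (rule ring_ideal_mult[OF J(1)])
  with p J show False by (simp add: mult_single)
qed

section \<open>Heights under morphisms\<close>

lemma peval_map:
  assumes "\<phi> 0 = 0" "\<psi> 0 = 0"
  shows "peval \<psi> (Poly_Mapping.map \<phi> p) x = peval (\<psi> \<circ> \<phi>) p x"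
proof -
  have lookup: "Poly_Mapping.lookup (Poly_Mapping.map \<phi> p) m = \<phi> (Poly_Mapping.lookup p m)" for m
    using assms(1) by (simp add: map.rep_eq when_def)
  then have "Poly_Mapping.keys (Poly_Mapping.map \<phi> p) \<subseteq> Poly_Mapping.keys p"
    using assms(1) by (auto simp: in_keys_iff)
  then have "peval \<psi> (Poly_Mapping.map \<phi> p) x =
      (\<Sum>m\<in>Poly_Mapping.keys p. \<psi> (\<phi> (Poly_Mapping.lookup p m)) * monomial_value m x)"
    by (subst peval_superset[of "Poly_Mapping.keys p"]) (auto simp: assms lookup)
  then show ?thesis by (simp add: peval_monomial_value)
qed

text \<open>A coordinate functional for a basis of the complex numbers over the rationals that
  contains 1. Applied to coefficients, it turns complex identities at rational points into rational
  ones.\<close>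

lemma exists_rational_functional:
  "\<exists>\<phi> :: complex \<Rightarrow> rat. \<phi> 1 = 1 \<and> (\<forall>a b. \<phi> (a + b) = \<phi> a + \<phi> b) \<and> (\<forall>r a. \<phi> (a * of_rat r) = \<phi> a * r)"
proof -
  interpret vector_space_pair "\<lambda>r (z::complex). of_rat r * z" "(*) :: rat \<Rightarrow> rat \<Rightarrow> rat"
    by unfold_locales (auto simp: algebra_simps of_rat_add of_rat_mult)
  have "vs1.independent {1}"
    using vs1.independent_insert[of 1 "{}"] by (simp add: vs1.independent_empty)
  from linear_independent_extend[OF this, of "\<lambda>_. 1"] obtain \<phi>
    where \<phi>: "Vector_Spaces.linear (\<lambda>r (z::complex). of_rat r * z) (*) \<phi>" "\<phi> 1 = 1" by auto
  then interpret \<phi>: Vector_Spaces.linear "\<lambda>r (z::complex). of_rat r * z" "(*)" \<phi> by blast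
  from \<phi>(2) \<phi>.add \<phi>.scale show ?thesis
    by (intro exI[of _ \<phi>]) (auto simp: mult.commute)
qed

lemma peval_of_rat_vec:
  "peval of_rat p (\<chi> i. of_rat (x $ i)) = (of_rat (peval id p x) :: 'a::field_char_0)"
proof -
  have prod: "of_rat (\<Prod>i\<in>A. t i) = (\<Prod>i\<in>A. of_rat (t i) :: 'a)" for t :: "'b \<Rightarrow> rat" and A
    by (induction A rule: infinite_finite_induct) (auto simp: of_rat_mult)
  show ?thesis
    by (simp add: peval_def of_rat_sum of_rat_mult of_rat_power prod)
qed

text \<open>The f_i and X_j - 1 have no common complex zero, since z_j = 1 excludes z = 0. So 1 is a
  combination of them, and at points with x_j = 1 the multiple of X_j - 1 drops out. An identity of
  values at rational points is enough for the estimates below.\<close>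

lemma morphism_certificate:
  fixes f :: "'n::finite \<Rightarrow> ('n, rat) mvpoly"
  assumes f: "morphism_of_degree d f"
  shows "\<exists>g :: 'n \<Rightarrow> ('n, rat) mvpoly. \<forall>x. x $ j = 1 \<longrightarrow> (\<Sum>i\<in>UNIV. peval id (g i) x * peval id (f i) x) = 1"
proof -
  define F where "F i = Poly_Mapping.map (of_rat :: rat \<Rightarrow> complex) (f i)" for i
  have F: "peval id (F i) z = peval of_rat (f i) z" for i z
    by (simp add: F_def peval_map)
  define w :: "('n, complex) mvpoly" where "w = Poly_Mapping.single (Poly_Mapping.single j 1) 1 - 1"
  have w: "peval id w z = z $ j - 1" for z
    using peval_id.peval_variable[of j z] by (simp add: w_def peval_id.peval_diff)
  define I where "I = {(\<Sum>i\<in>UNIV. g i * F i) + h * w | g h. True}"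
  have I: "(\<Sum>i\<in>UNIV. g i * F i) + h * w \<in> I" for g h by (auto simp: I_def)
  have "ring_ideal I"
    unfolding ring_ideal_def
  proof (intro conjI ballI allI)
    show "0 \<in> I" using I[of "\<lambda>_. 0" 0] by simp
  next
    fix a b assume "a \<in> I" "b \<in> I"
    then obtain g h g' h' where ab: "a = (\<Sum>i\<in>UNIV. g i * F i) + h * w"
        "b = (\<Sum>i\<in>UNIV. g' i * F i) + h' * w"
      unfolding I_def by blast
    have "a + b = (\<Sum>i\<in>UNIV. (g i + g' i) * F i) + (h + h') * w"
      unfolding ab by (simp add: algebra_simps sum.distrib)
    then show "a + b \<in> I" by (simp only: I)
  next
    fix a r assume "a \<in> I"
    then obtain g h where a: "a = (\<Sum>i\<in>UNIV. g i * F i) + h * w" unfolding I_def by blast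
    have "r * a = (\<Sum>i\<in>UNIV. (r * g i) * F i) + (r * h) * w"
      unfolding a by (simp add: algebra_simps sum_distrib_left)
    then show "r * a \<in> I" by (simp only: I)
  qed
  moreover have "\<exists>p\<in>I. peval id p z \<noteq> 0" for z :: "complex^'n"
  proof (cases "z $ j = 1")
    case False
    moreover have "w \<in> I" using I[of "\<lambda>_. 0" 1] by simp
    ultimately show ?thesis using w[of z] by force
  next
    case True
    then have "z \<noteq> 0" by auto
    then obtain k where "peval of_rat (f k) z \<noteq> 0" using f by (auto simp: morphism_of_degree_def)
    moreover have "(\<Sum>i\<in>UNIV. (if i = k then 1 else 0) * F i) = (\<Sum>i\<in>UNIV. if i = k then F k else 0)"
      by (intro sum.cong) auto
    then have "F k \<in> I" using I[of "\<lambda>i. if i = k then 1 else 0" 0] by simp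
    ultimately show ?thesis using F by metis
  qed
  ultimately have "1 \<in> I" by (rule weak_nullstellensatz)
  then obtain G h where G: "1 = (\<Sum>i\<in>UNIV. G i * F i) + h * w" unfolding I_def by blast
  obtain \<phi> :: "complex \<Rightarrow> rat" where \<phi>: "\<phi> 1 = 1" "\<And>a b. \<phi> (a + b) = \<phi> a + \<phi> b"
      "\<And>r a. \<phi> (a * of_rat r) = \<phi> a * r"
    using exists_rational_functional by blast
  have \<phi>0: "\<phi> 0 = 0" using \<phi>(2)[of 0 0] by simp
  have \<phi>_sum: "\<phi> (\<Sum>a\<in>A. t a) = (\<Sum>a\<in>A. \<phi> (t a))" for t :: "'b \<Rightarrow> complex" and A
    by (induction A rule: infinite_finite_induct) (auto simp: \<phi> \<phi>0)
  show ?thesis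
  proof (intro exI[of _ "\<lambda>i. Poly_Mapping.map \<phi> (G i)"] allI impI)
    fix x :: "rat^'n" assume x: "x $ j = 1"
    let ?z = "\<chi> i. of_rat (x $ i) :: complex^'n"
    have mono: "monomial_value m ?z = of_rat (monomial_value m x)" for m
      using peval_of_rat_vec[of "Poly_Mapping.single m 1" x, where 'a = complex]
      by (simp add: peval_of_rat.peval_single peval_id.peval_single)
    \<comment> \<open>Monomials take rational values at x, so applying the functional to a value
      amounts to applying it to the coefficients.\<close>
    have \<phi>G: "\<phi> (peval id (G i) ?z) = peval id (Poly_Mapping.map \<phi> (G i)) x" for i
      by (simp add: peval_map \<phi>0) (simp add: peval_monomial_value \<phi>_sum mono \<phi>)
    have "1 = peval id ((\<Sum>i\<in>UNIV. G i * F i) + h * w) ?z"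
      by (simp flip: G)
    also have "\<dots> = (\<Sum>i\<in>UNIV. peval id (G i) ?z * of_rat (peval id (f i) x))"
      by (simp add: peval_id.peval_add peval_id.peval_sum peval_id.peval_mult F w x peval_of_rat_vec)
    finally have "\<phi> 1 = \<phi> (\<Sum>i\<in>UNIV. peval id (G i) ?z * of_rat (peval id (f i) x))" by (rule arg_cong)
    then show "(\<Sum>i\<in>UNIV. peval id (Poly_Mapping.map \<phi> (G i)) x * peval id (f i) x) = 1"
      by (simp add: \<phi> \<phi>_sum \<phi>G)
  qed
qed

section \<open>Common divisors, denominators and sizes of values\<close>

lemma Gcd_powers_eq_1:
  fixes x :: "'n::finite \<Rightarrow> int"
  assumes "Gcd (range x) = 1"
  shows "Gcd (range (\<lambda>i. x i ^ k)) = 1"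
proof (rule ccontr)
  assume "Gcd (range (\<lambda>i. x i ^ k)) \<noteq> 1"
  then have "\<not> is_unit (Gcd (range (\<lambda>i. x i ^ k)))"
    using Gcd_int_greater_eq_0[of "range (\<lambda>i. x i ^ k)"] by simp
  moreover have "Gcd (range (\<lambda>i. x i ^ k)) \<noteq> 0"
  proof
    assume "Gcd (range (\<lambda>i. x i ^ k)) = 0"
    then have "x i = 0" for i by (auto simp: image_subset_iff)
    with assms show False by simp
  qed
  ultimately obtain q where q: "prime q" "q dvd Gcd (range (\<lambda>i. x i ^ k))"
    by (meson prime_divisor_exists)
  have "q dvd x i" for i
    using q by (meson Gcd_dvd dvd_trans prime_dvd_power rangeI)
  then have "q dvd Gcd (range x)" by (auto intro: Gcd_greatest)
  with assms have "is_unit q" by simp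
  with q(1) show False using not_prime_unit by blast
qed

lemma mvpoly_rat_denominator:
  "\<exists>R::int. R > 0 \<and> (\<forall>m. \<exists>a. of_int R * Poly_Mapping.lookup p m = (of_int a :: rat))"
proof -
  let ?q = "\<lambda>m. snd (quotient_of (Poly_Mapping.lookup p m))"
  define R where "R = (\<Prod>m\<in>Poly_Mapping.keys p. ?q m)"
  have "R > 0" unfolding R_def by (intro prod_pos) (simp add: quotient_of_denom_pos')
  moreover have "\<exists>a. of_int R * Poly_Mapping.lookup p m = (of_int a :: rat)" for m
  proof (cases "m \<in> Poly_Mapping.keys p")
    case True
    then have "?q m dvd R" unfolding R_def by (intro dvd_prodI) auto
    then obtain k where k: "R = ?q m * k" by blast
    have "Poly_Mapping.lookup p m = of_int (fst (quotient_of (Poly_Mapping.lookup p m))) / of_int (?q m)"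
      by (metis prod.collapse quotient_of_div)
    moreover have "?q m \<noteq> 0" by (metis quotient_of_denom_pos' less_irrefl)
    ultimately have "of_int R * Poly_Mapping.lookup p m = of_int (k * fst (quotient_of (Poly_Mapping.lookup p m)))"
      by (subst k) (simp add: field_simps)
    then show ?thesis by blast
  next
    case False
    then show ?thesis by (intro exI[of _ 0]) (simp add: in_keys_iff)
  qed
  ultimately show ?thesis by blast
qed

text \<open>R clears the coefficients; a monomial of degree k at x / x_j has a denominator dividing
  x_j ^ k, and k is at most E.\<close>

lemma peval_dehomogenized_integral:
  fixes g :: "('n::finite, rat) mvpoly" and x :: "int^'n"
  assumes R: "\<And>m. \<exists>a. of_int R * Poly_Mapping.lookup g m = of_int a"
    and E: "\<And>m. m \<in> Poly_Mapping.keys g \<Longrightarrow> mdeg m \<le> E"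
    and xj: "x $ j \<noteq> 0"
  shows "\<exists>b. of_int (R * x $ j ^ E) * peval id g (\<chi> i. of_int (x $ i) / of_int (x $ j)) = of_int b"
proof -
  obtain a where a: "\<And>m. of_int R * Poly_Mapping.lookup g m = of_int (a m)" using R by metis
  let ?v = "\<lambda>m. monomial_value m x"
  let ?y = "\<chi> i. of_int (x $ i) / of_int (x $ j) :: rat^'n"
  have mdeg: "of_int (x $ j ^ mdeg m) * monomial_value m ?y = of_int (?v m)" for m
    using xj by (simp add: monomial_value_def mdeg_def power_sum power_divide flip: prod.distrib)
  have mono: "of_int (x $ j ^ E) * monomial_value m ?y = of_int (x $ j ^ (E - mdeg m) * ?v m)"
    if "mdeg m \<le> E" for m
  proof -
    have "x $ j ^ E = x $ j ^ (E - mdeg m) * x $ j ^ mdeg m"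
      using that by (simp flip: power_add)
    then show ?thesis using mdeg[of m] by (simp only: of_int_mult mult.assoc)
  qed
  have "of_int (R * x $ j ^ E) * peval id g (\<chi> i. of_int (x $ i) / of_int (x $ j))
      = (\<Sum>m\<in>Poly_Mapping.keys g. (of_int R * Poly_Mapping.lookup g m) *
          (of_int (x $ j ^ E) * monomial_value m (\<chi> i. of_int (x $ i) / of_int (x $ j))))"
    by (simp add: peval_monomial_value sum_distrib_left ac_simps)
  also have "\<dots> = (\<Sum>m\<in>Poly_Mapping.keys g. of_int (a m * (x $ j ^ (E - mdeg m) * ?v m)))"
    by (intro sum.cong refl) (simp only: a mono[OF E] of_int_mult)
  also have "\<dots> = of_int (\<Sum>m\<in>Poly_Mapping.keys g. a m * (x $ j ^ (E - mdeg m) * ?v m))"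
    by (rule of_int_sum[symmetric])
  finally show ?thesis by (rule exI)
qed

lemma abs_peval_le:
  fixes g :: "('n::finite, 'b::zero) mvpoly" and x :: "'a::linordered_idom^'n"
  assumes "\<And>i. \<bar>x $ i\<bar> \<le> M" "1 \<le> M" "\<And>m. m \<in> Poly_Mapping.keys g \<Longrightarrow> mdeg m \<le> e"
  shows "\<bar>peval \<phi> g x\<bar> \<le> (\<Sum>m\<in>Poly_Mapping.keys g. \<bar>\<phi> (Poly_Mapping.lookup g m)\<bar>) * M ^ e"
proof -
  have mono: "\<bar>monomial_value m x\<bar> \<le> M ^ e" if "m \<in> Poly_Mapping.keys g" for m
  proof -
    have "\<bar>monomial_value m x\<bar> \<le> (\<Prod>i\<in>UNIV. M ^ Poly_Mapping.lookup m i)"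
      unfolding monomial_value_def abs_prod power_abs
      by (intro prod_mono conjI power_mono zero_le_power assms abs_ge_zero)
    also have "\<dots> = M ^ mdeg m" by (simp add: mdeg_def power_sum)
    also have "\<dots> \<le> M ^ e" using assms that by (intro power_increasing) auto
    finally show ?thesis .
  qed
  have "\<bar>peval \<phi> g x\<bar> \<le> (\<Sum>m\<in>Poly_Mapping.keys g. \<bar>\<phi> (Poly_Mapping.lookup g m) * monomial_value m x\<bar>)"
    unfolding peval_monomial_value by (rule sum_abs)
  also have "\<dots> \<le> (\<Sum>m\<in>Poly_Mapping.keys g. \<bar>\<phi> (Poly_Mapping.lookup g m)\<bar> * M ^ e)"
    by (intro sum_mono) (auto simp: abs_mult intro!: mult_left_mono mono)
  finally show ?thesis by (simp add: sum_distrib_right)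
qed

text \<open>For coprime coordinates this is the exponential height, the nonarchimedean maxima being
  1.\<close>

abbreviation house :: "int^'n::finite \<Rightarrow> real" where
  "house \<equiv> max_abs_at Archimedean"

lemma abs_le_house: "real_of_int \<bar>x $ i\<bar> \<le> house x"
  unfolding max_abs_at_def by (intro Max_ge) (auto intro!: image_eqI[of _ _ i])

lemma house_attained: "\<exists>i. house x = real_of_int \<bar>x $ i\<bar>"
proof -
  have "house x \<in> range (\<lambda>i. abs_at Archimedean (x $ i))"
    unfolding max_abs_at_def by (intro Max_in) auto
  then show ?thesis by auto
qed

lemma house_ge_1:
  assumes "x \<in> rat_points"
  shows "1 \<le> house x"
proof -
  have "\<exists>i. x $ i \<noteq> 0"
    using assms by (rule contrapos_pp) (simp add: rat_points_def)
  then obtain i where "x $ i \<noteq> 0" by blast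
  then show ?thesis using abs_le_house[of x i] by linarith
qed

lemma peval_scaled:
  assumes "homogeneous d p" "t \<noteq> (0::rat)"
  shows "peval id p (\<chi> i. x $ i / t) = peval id p x / t ^ d"
proof -
  have "(\<chi> i. x $ i / t) = inverse t *s x" by (simp add: vec_eq_iff divide_inverse mult.commute)
  then show ?thesis using assms(1) by (simp add: peval_id.peval_homogeneous divide_inverse power_inverse mult.commute)
qed

text \<open>
  The certificate at \<open>x / x\<^sub>j\<close> serves twice: taking \<open>x\<^sub>j\<close> of maximal absolute value it bounds the
  archimedean size of \<open>f x\<close> from below, and cleared of denominators for every \<open>j\<close> it bounds the
  common factor that is divided out of \<open>f x\<close>.
\<close>

lemma house_image_lower_bound:
  fixes f :: "'n::finite \<Rightarrow> ('n, rat) mvpoly"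
  assumes f: "morphism_of_degree d f"
  shows "\<exists>K>0. \<forall>x y c. Gcd (range (\<lambda>i. x $ i)) = 1 \<longrightarrow> Gcd (range (\<lambda>i. y $ i)) = 1 \<longrightarrow> c \<noteq> 0 \<longrightarrow>
      (\<forall>i. peval id (f i) (\<chi> j. of_int (x $ j)) = c * of_int (y $ i)) \<longrightarrow>
      house x ^ d \<le> K * house y"
proof -
  have hom: "homogeneous d (f i)" for i using f by (simp add: morphism_of_degree_def)
  have "\<forall>j. \<exists>g :: 'n \<Rightarrow> ('n, rat) mvpoly.
      \<forall>x. x $ j = 1 \<longrightarrow> (\<Sum>i\<in>UNIV. peval id (g i) x * peval id (f i) x) = 1"
    using morphism_certificate[OF f] by blast
  then obtain g where g: "\<And>j x. x $ j = 1 \<Longrightarrow> (\<Sum>i\<in>UNIV. peval id (g j i) x * peval id (f i) x) = 1"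
    by metis
  have "\<exists>R. \<forall>p. R p > 0 \<and> (\<forall>m. \<exists>a. of_int (R p) * Poly_Mapping.lookup p m = (of_int a :: rat))"
    for p :: "('n, rat) mvpoly"
    using mvpoly_rat_denominator by metis
  then obtain R0 where R0: "\<And>p :: ('n, rat) mvpoly. R0 p > 0"
      "\<And>p :: ('n, rat) mvpoly. \<And>m. \<exists>a. of_int (R0 p) * Poly_Mapping.lookup p m = (of_int a :: rat)"
    by metis
  define R where "R = (\<Prod>j\<in>UNIV. \<Prod>i\<in>UNIV. R0 (g j i))"
  have "R > 0" unfolding R_def by (intro prod_pos) (simp add: R0)
  have R: "\<exists>a. of_int R * Poly_Mapping.lookup (g j i) m = (of_int a :: rat)" for i j m
  proof -
    have "R0 (g j i) dvd (\<Prod>i\<in>UNIV. R0 (g j i))" by (intro dvd_prodI) auto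
    also have "\<dots> dvd R" unfolding R_def by (intro dvd_prodI) auto
    finally obtain k where "R = R0 (g j i) * k" by blast
    moreover obtain a where "of_int (R0 (g j i)) * Poly_Mapping.lookup (g j i) m = (of_int a :: rat)"
      using R0 by blast
    ultimately have "of_int R * Poly_Mapping.lookup (g j i) m = (of_int (k * a) :: rat)"
      by (simp add: mult.commute mult.left_commute)
    then show ?thesis by blast
  qed
  define E where "E = (\<Sum>j\<in>UNIV. \<Sum>i\<in>UNIV. \<Sum>m\<in>Poly_Mapping.keys (g j i). mdeg m)"
  have E: "mdeg m \<le> E" if "m \<in> Poly_Mapping.keys (g j i)" for i j m
  proof -
    have "mdeg m \<le> (\<Sum>m\<in>Poly_Mapping.keys (g j i). mdeg m)" using that by (intro member_le_sum) auto
    also have "\<dots> \<le> (\<Sum>i\<in>UNIV. \<Sum>m\<in>Poly_Mapping.keys (g j i). mdeg m)"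
      by (rule member_le_sum[where f = "\<lambda>i. \<Sum>m\<in>Poly_Mapping.keys (g j i). mdeg m"]) auto
    also have "\<dots> \<le> E"
      unfolding E_def by (rule member_le_sum[where f = "\<lambda>j. \<Sum>i\<in>UNIV. \<Sum>m\<in>Poly_Mapping.keys (g j i). mdeg m"]) auto
    finally show ?thesis .
  qed
  define B where "B j i = (\<Sum>m\<in>Poly_Mapping.keys (g j i). \<bar>Poly_Mapping.lookup (g j i) m\<bar>)" for i j
  have B0: "B j i \<ge> 0" for i j by (simp add: B_def sum_nonneg)
  \<comment> \<open>R will bound the scalar c and the sum of the B j i the values of the
    certificate; the summand 1 ensures that K is positive.\<close>
  define K where "K = of_int R * (\<Sum>j\<in>UNIV. \<Sum>i\<in>UNIV. B j i) + 1"
  have "K > 0" using \<open>R > 0\<close> B0 by (simp add: K_def sum_nonneg add_nonneg_pos)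
  have "house x ^ d \<le> of_rat K * house y"
    if x: "Gcd (range (\<lambda>i. x $ i)) = 1" and y: "Gcd (range (\<lambda>i. y $ i)) = 1" and "c \<noteq> 0"
      and xy: "\<And>i. peval id (f i) (\<chi> j. of_int (x $ j)) = c * of_int (y $ i)"
    for x y :: "int^'n" and c
  proof -
    let ?x = "\<lambda>j. \<chi> i. of_int (x $ i) / of_int (x $ j) :: rat^'n"
    \<comment> \<open>The certificate at x / x_j after inserting f_i(x / x_j) = c y_i / x_j ^ d and
      multiplying by x_j ^ d.\<close>
    have cert: "of_int (x $ j) ^ d = c * (\<Sum>i\<in>UNIV. peval id (g j i) (?x j) * of_int (y $ i))"
      if "x $ j \<noteq> 0" for j
    proof -
      have "peval id (f i) (?x j) = c * of_int (y $ i) / of_int (x $ j) ^ d" for i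
        using peval_scaled[OF hom[of i], of "of_int (x $ j)" "\<chi> i. of_int (x $ i)"] that by (simp add: xy)
      moreover have "(\<Sum>i\<in>UNIV. peval id (g j i) (?x j) * peval id (f i) (?x j)) = 1"
        using that by (intro g) simp
      ultimately have "(\<Sum>i\<in>UNIV. c * (peval id (g j i) (?x j) * of_int (y $ i))) / of_int (x $ j) ^ d = 1"
        by (simp add: sum_divide_distrib ac_simps)
      then show ?thesis using that by (simp flip: sum_distrib_left)
    qed
    obtain p q where pq: "quotient_of c = (p, q)" by fastforce
    have q: "q > 0" "coprime p q" "c = of_int p / of_int q"
      using pq by (auto intro: quotient_of_denom_pos quotient_of_coprime quotient_of_div)
    have "p \<noteq> 0" using q \<open>c \<noteq> 0\<close> by auto
    \<comment> \<open>The numerator p of c is the common factor removed from f(x). The exponent is E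
      + d plus one so that the power also vanishes for x_j = 0 when E + d = 0.\<close>
    have "p dvd R * x $ j ^ Suc (E + d)" for j
    proof (cases "x $ j = 0")
      case True
      then show ?thesis by simp
    next
      case False
      have "\<exists>b. of_int (R * x $ j ^ E) * peval id (g j i) (?x j) = of_int b" for i
        by (rule peval_dehomogenized_integral) (use R E False in auto)
      then obtain b where b: "\<And>i. of_int (R * x $ j ^ E) * peval id (g j i) (?x j) = (of_int (b i) :: rat)"
        by metis
      have "of_int (R * x $ j ^ (E + d)) = of_int (R * x $ j ^ E) * (of_int (x $ j) ^ d :: rat)"
        by (simp add: power_add)
      also have "\<dots> = c * (\<Sum>i\<in>UNIV. (of_int (R * x $ j ^ E) * peval id (g j i) (?x j)) * of_int (y $ i))"
        by (simp only: cert[OF False] sum_distrib_left ac_simps)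
      also have "\<dots> = c * of_int (\<Sum>i\<in>UNIV. b i * y $ i)" by (simp only: b) simp
      finally have "(of_int (q * (R * x $ j ^ (E + d))) :: rat) = of_int (p * (\<Sum>i\<in>UNIV. b i * y $ i))"
        using q by (simp add: field_simps)
      then have "q * (R * x $ j ^ (E + d)) = p * (\<Sum>i\<in>UNIV. b i * y $ i)" by (simp only: of_int_eq_iff)
      then have "p dvd q * (R * x $ j ^ (E + d))" by simp
      with q(2) have "p dvd R * x $ j ^ (E + d)" by (simp add: coprime_dvd_mult_right_iff)
      then show ?thesis by (metis dvd_mult mult.left_commute power_Suc)
    qed
    \<comment> \<open>The coordinates of x are coprime, hence so are their powers, and only R
      remains for p to divide.\<close>
    then have "p dvd Gcd (range (\<lambda>j. R * x $ j ^ Suc (E + d)))" by (auto intro: Gcd_greatest)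
    also have "\<dots> = R * Gcd (range (\<lambda>j. x $ j ^ Suc (E + d)))"
      using Gcd_mult[of R "range (\<lambda>j. x $ j ^ Suc (E + d))"] \<open>R > 0\<close> by (simp add: image_image)
    also have "\<dots> = R" using Gcd_powers_eq_1[OF x, of "Suc (E + d)"] by simp
    finally have "\<bar>p\<bar> \<le> R" using \<open>R > 0\<close> by (simp add: zdvd_imp_le)
    have "1 * \<bar>rat_of_int p\<bar> \<le> of_int q * \<bar>of_int p\<bar>" using q(1) by (intro mult_right_mono) auto
    then have "\<bar>c\<bar> \<le> \<bar>of_int p\<bar>" using q(1) by (simp add: q(3) abs_divide field_simps)
    also have "\<dots> \<le> of_int R" using \<open>\<bar>p\<bar> \<le> R\<close> by (simp flip: of_int_abs)
    finally have cR: "\<bar>c\<bar> \<le> of_int R" .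
    obtain j where j: "house x = real_of_int \<bar>x $ j\<bar>" using house_attained by blast
    obtain k where k: "house y = real_of_int \<bar>y $ k\<bar>" using house_attained by blast
    have xj: "\<bar>x $ i\<bar> \<le> \<bar>x $ j\<bar>" for i using abs_le_house[of x i] j by linarith
    have yk: "\<bar>y $ i\<bar> \<le> \<bar>y $ k\<bar>" for i using abs_le_house[of y i] k by linarith
    have "x $ j \<noteq> 0"
    proof
      assume "x $ j = 0"
      then have "x $ i = 0" for i using xj[of i] by simp
      with x show False by simp
    qed
    have "\<bar>peval id (g j i) (?x j)\<bar> \<le> B j i" for i
    proof -
      have "\<bar>?x j $ i\<bar> \<le> 1" for i
        using xj[of i] \<open>x $ j \<noteq> 0\<close> by (simp add: abs_divide divide_le_eq_1 flip: of_int_abs)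
      then have "\<bar>peval id (g j i) (?x j)\<bar> \<le> B j i * 1 ^ E"
        unfolding B_def using abs_peval_le[of "?x j" 1 "g j i" E id] E by simp
      then show ?thesis by simp
    qed
    then have "\<bar>\<Sum>i\<in>UNIV. peval id (g j i) (?x j) * of_int (y $ i)\<bar> \<le> (\<Sum>i\<in>UNIV. B j i * of_int \<bar>y $ k\<bar>)"
      by (intro order_trans[OF sum_abs] sum_mono) (use yk B0 in \<open>auto simp: abs_mult simp flip: of_int_abs intro!: mult_mono\<close>)
    also have "\<dots> = (\<Sum>i\<in>UNIV. B j i) * of_int \<bar>y $ k\<bar>" by (simp add: sum_distrib_right)
    also have "\<dots> \<le> (\<Sum>j\<in>UNIV. \<Sum>i\<in>UNIV. B j i) * of_int \<bar>y $ k\<bar>"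
      by (intro mult_right_mono member_le_sum[where f = "\<lambda>j. \<Sum>i\<in>UNIV. B j i"]) (auto intro!: sum_nonneg B0)
    finally have *: "\<bar>\<Sum>i\<in>UNIV. peval id (g j i) (?x j) * of_int (y $ i)\<bar>
        \<le> (\<Sum>j\<in>UNIV. \<Sum>i\<in>UNIV. B j i) * of_int \<bar>y $ k\<bar>" .
    have "(of_int \<bar>x $ j\<bar> :: rat) ^ d = \<bar>c\<bar> * \<bar>\<Sum>i\<in>UNIV. peval id (g j i) (?x j) * of_int (y $ i)\<bar>"
      by (simp add: cert[OF \<open>x $ j \<noteq> 0\<close>] flip: abs_mult power_abs)
    also have "\<dots> \<le> of_int R * ((\<Sum>j\<in>UNIV. \<Sum>i\<in>UNIV. B j i) * of_int \<bar>y $ k\<bar>)"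
      using \<open>R > 0\<close> by (intro mult_mono cR *) auto
    also have "\<dots> \<le> K * of_int \<bar>y $ k\<bar>"
      by (simp add: K_def distrib_right mult.assoc)
    finally have "real_of_rat (of_int \<bar>x $ j\<bar> ^ d) \<le> real_of_rat (K * of_int \<bar>y $ k\<bar>)" by (simp only: of_rat_less_eq)
    then show ?thesis by (simp add: j k of_rat_mult of_rat_power del: of_int_abs)
  qed
  with \<open>K > 0\<close> show ?thesis by (intro exI[of _ "of_rat K"]) auto
qed

section \<open>Factorization of forms\<close>

text \<open>The substitution \<open>X\<^sub>i \<mapsto> X\<^sub>i t\<close>: the coefficient of \<open>t\<^sup>k\<close> is the homogeneous component of degree \<open>k\<close>.\<close>

definition grading_poly :: "('n::finite, 'b::comm_ring_1) mvpoly \<Rightarrow> ('n, 'b) mvpoly poly" where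
  "grading_poly p = peval (\<lambda>c. [:mconst c:]) p
    (monom 1 1 *s (\<chi> i. [:Poly_Mapping.single (Poly_Mapping.single i 1) 1:]))"

lemma coeff_hom_grading: "coeff_hom (\<lambda>c. [:mconst c:] :: ('n, 'b::comm_ring_1) mvpoly poly)"
  by unfold_locales (auto simp: single_add mult_single one_pCons mult.commute)

lemma grading_poly_mult: "grading_poly (p * q) = grading_poly p * grading_poly q"
  unfolding grading_poly_def by (rule coeff_hom.peval_mult[OF coeff_hom_grading])

lemma monomial_value_const_poly:
  "monomial_value m (\<chi> i. [:a i:]) = [:monomial_value m (\<chi> i. a i):]" for a :: "'n::finite \<Rightarrow> 'a::comm_ring_1"
proof -
  have "(\<Prod>i\<in>A. [:b i:]) = [:\<Prod>i\<in>A. b i:]" for A and b :: "'n \<Rightarrow> 'a"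
    by (induction A rule: infinite_finite_induct) (auto simp: one_pCons)
  then show ?thesis by (simp add: monomial_value_def poly_const_pow)
qed

lemma grading_poly_eq:
  fixes p :: "('n::finite, 'b::comm_ring_1) mvpoly"
  shows "grading_poly p = (\<Sum>m\<in>Poly_Mapping.keys p. monom (Poly_Mapping.single m (Poly_Mapping.lookup p m)) (mdeg m))"
  unfolding grading_poly_def peval_monomial_value
proof (intro sum.cong refl)
  fix m :: "'n \<Rightarrow>\<^sub>0 nat"
  have "monomial_value m (monom 1 1 *s (\<chi> i. [:Poly_Mapping.single (Poly_Mapping.single i 1) 1:])) =
      monom (Poly_Mapping.single m (1::'b)) (mdeg m)"
    using monomial_value_variables[of m, where 'b = 'b]
    by (simp add: monomial_value_scale monomial_value_const_poly monom_power smult_monom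
        mult.commute[of "monom _ _"])
  then show "[:mconst (Poly_Mapping.lookup p m):] *
      monomial_value m (monom 1 1 *s (\<chi> i. [:Poly_Mapping.single (Poly_Mapping.single i 1) 1:])) =
      monom (Poly_Mapping.single m (Poly_Mapping.lookup p m)) (mdeg m)"
    by (simp add: smult_monom mult_single)
qed

lemma coeff_grading_poly:
  "Poly_Mapping.lookup (coeff (grading_poly p) k) m = (if mdeg m = k then Poly_Mapping.lookup p m else 0)"
proof -
  have "Poly_Mapping.lookup (coeff (grading_poly p) k) m =
      (\<Sum>l\<in>Poly_Mapping.keys p. if l = m then (if mdeg m = k then Poly_Mapping.lookup p m else 0) else 0)"
    unfolding grading_poly_eq coeff_sum lookup_sum
    by (intro sum.cong) (auto simp: lookup_single when_def)
  then show ?thesis by (simp add: in_keys_iff)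
qed

lemma grading_poly_homogeneous: "homogeneous d p \<Longrightarrow> grading_poly p = monom p d"
  by (intro poly_eqI poly_mapping_eqI)
    (auto simp: coeff_grading_poly homogeneous_def in_keys_iff)

lemma homogeneous_of_grading_poly:
  assumes "grading_poly p = monom q d"
  shows "homogeneous d p"
  unfolding homogeneous_def
proof
  fix m assume "m \<in> Poly_Mapping.keys p"
  then have "Poly_Mapping.lookup (coeff (grading_poly p) (mdeg m)) m \<noteq> 0"
    by (simp add: coeff_grading_poly in_keys_iff)
  then show "mdeg m = d" unfolding assms by (auto split: if_splits)
qed

text \<open>Degree and order at 0 are both additive and both sum to d. The order never exceeds the
  degree, so they agree for P, which is therefore a constant times a power of the variable.\<close>

lemma mult_eq_monom:
  fixes P Q :: "'a::idom poly"
  assumes "P * Q = monom c d" "c \<noteq> 0"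
  shows "\<exists>s k. k \<le> d \<and> P = monom s k"
proof -
  have "P \<noteq> 0" "Q \<noteq> 0" using assms by auto
  then have "degree P + degree Q = d" and "order 0 P + order 0 Q = d"
    using assms by (metis degree_monom_eq degree_mult_eq) (metis assms \<open>P \<noteq> 0\<close> \<open>Q \<noteq> 0\<close> no_zero_divisors order_0_monom order_mult)
  moreover have "order 0 P \<le> degree P" "order 0 Q \<le> degree Q"
    using \<open>P \<noteq> 0\<close> \<open>Q \<noteq> 0\<close> by (auto intro: order_degree)
  ultimately have k: "order 0 P = degree P" "degree P \<le> d" by auto
  have "[:0, 1:] ^ degree P dvd P" using order_1[of 0 P] k by simp
  then obtain S where S: "P = [:0, 1:] ^ degree P * S" by blast
  with \<open>P \<noteq> 0\<close> have "S \<noteq> 0" by auto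
  have "degree P = degree ([:0, 1:] ^ degree P :: 'a poly) + degree S"
    by (subst S, rule degree_mult_eq) (use \<open>S \<noteq> 0\<close> in auto)
  then have "degree S = 0" by (simp add: degree_power_eq)
  then obtain s where "S = [:s:]" using degree_eq_zeroE by blast
  moreover have "monom s (degree P) = [:0, 1:] ^ degree P * [:s:]" by (simp add: monom_altdef)
  ultimately have "P = monom s (degree P)" using S by metis
  with k show ?thesis by blast
qed

text \<open>A polynomial is a form exactly if its multiplicative image under
  \<open>grading_poly\<close> is a monomial in t, and factors of a nonzero monomial in t are
  monomials.\<close>

lemma homogeneous_factor:
  fixes A B :: "('n::{finite,linorder}, 'b::idom) mvpoly"
  assumes "homogeneous d (A * B)" "A * B \<noteq> 0"
  obtains a b where "homogeneous a A" "homogeneous b B" "a + b = d"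
proof -
  have AB: "grading_poly A * grading_poly B = monom (A * B) d"
    using grading_poly_homogeneous[OF assms(1)] by (simp add: grading_poly_mult)
  obtain s k where "grading_poly A = monom s k" using mult_eq_monom[OF AB assms(2)] by blast
  moreover obtain t l where "grading_poly B = monom t l"
    using mult_eq_monom[of "grading_poly B" "grading_poly A", OF _ assms(2)] AB by (metis mult.commute)
  ultimately have hom: "homogeneous k A" "homogeneous l B" by (auto intro: homogeneous_of_grading_poly)
  then have "homogeneous (k + l) (A * B)" by (rule homogeneous_mult)
  then have "k + l = d" using assms by (metis total_degree_homogeneous)
  with hom that show ?thesis by blast
qed

section \<open>Constants, units and the decomposition into prime forms\<close>

lemma homogeneous_0_iff: "homogeneous 0 p \<longleftrightarrow> p = mconst (Poly_Mapping.lookup p 0)"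
proof
  assume p: "homogeneous 0 p"
  show "p = mconst (Poly_Mapping.lookup p 0)"
  proof (rule poly_mapping_eqI)
    fix k
    show "Poly_Mapping.lookup p k = Poly_Mapping.lookup (mconst (Poly_Mapping.lookup p 0)) k"
      using p by (cases "k = 0") (auto simp: homogeneous_def lookup_single mdeg_eq_0_iff in_keys_iff when_def)
  qed
next
  assume "p = mconst (Poly_Mapping.lookup p 0)"
  then show "homogeneous 0 p" by (metis homogeneous_single mdeg_0)
qed

lemma mconst_unit: "c dvd 1 \<Longrightarrow> (mconst c :: ('n, 'b::comm_ring_1) mvpoly) dvd 1"
  by (metis dvdE dvdI mult_single add_0 single_one)

lemma lookup_mconst_mult: "Poly_Mapping.lookup (mconst c * p) m = c * Poly_Mapping.lookup p m"
  for p :: "('n, 'b::comm_ring_1) mvpoly"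
  by (simp add: map.rep_eq when_def flip: mult_map_scale_conv_mult)

lemma is_unit_homogeneous:
  fixes p :: "('n::{finite,linorder}, 'b::idom) mvpoly"
  assumes "p dvd 1" "homogeneous d p"
  shows "d = 0"
proof -
  from assms(1) obtain q where "p * q = 1" by (metis dvdE)
  with homogeneous_1 obtain a b where "homogeneous a p" "a + b = 0"
    by (metis homogeneous_factor zero_neq_one)
  moreover have "p \<noteq> 0" using \<open>p * q = 1\<close> by auto
  ultimately show ?thesis using assms(2) by (metis add_is_0 total_degree_homogeneous)
qed

text \<open>A measure that decreases when a non-unit integer factor is split off, a step that leaves
  the degree unchanged.\<close>

definition coeff_norm :: "('n, int) mvpoly \<Rightarrow> nat" where
  "coeff_norm p = (\<Sum>m\<in>Poly_Mapping.keys p. nat \<bar>Poly_Mapping.lookup p m\<bar>)"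

lemma coeff_norm_mconst_mult_less:
  assumes "mconst c * p \<noteq> 0" "\<not> c dvd 1"
  shows "coeff_norm p < coeff_norm (mconst c * p)"
proof -
  have "c \<noteq> 0" using assms by auto
  then have "2 \<le> \<bar>c\<bar>" using assms(2) by auto
  have keys: "Poly_Mapping.keys (mconst c * p) = Poly_Mapping.keys p"
    using \<open>c \<noteq> 0\<close> by (auto simp: in_keys_iff lookup_mconst_mult)
  have "p \<noteq> 0" using assms by auto
  then have "Poly_Mapping.keys p \<noteq> {}" by simp
  then show ?thesis
    unfolding coeff_norm_def keys
  proof (intro sum_strict_mono)
    fix m assume "m \<in> Poly_Mapping.keys p"
    then have "1 * \<bar>Poly_Mapping.lookup p m\<bar> < \<bar>c\<bar> * \<bar>Poly_Mapping.lookup p m\<bar>"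
      using \<open>2 \<le> \<bar>c\<bar>\<close> by (intro mult_strict_right_mono) (auto simp: in_keys_iff)
    then show "nat \<bar>Poly_Mapping.lookup p m\<bar> < nat \<bar>Poly_Mapping.lookup (mconst c * p) m\<bar>"
      by (simp add: lookup_mconst_mult abs_mult)
  qed auto
qed

lemma irreducible_prime_form:
  fixes p :: "('n::{finite,linorder}, int) mvpoly"
  assumes "irreducible p" "homogeneous d p" "d > 0"
  shows "prime_form p \<or> prime_form (- p)"
proof -
  have "p \<noteq> 0" using assms(1) by auto
  then have "Max (Poly_Mapping.keys p) \<in> Poly_Mapping.keys p" by (intro Max_in) auto
  then have "Poly_Mapping.lookup p (Max (Poly_Mapping.keys p)) \<noteq> 0" by (simp add: in_keys_iff)
  moreover have "irreducible (- p)"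
  proof (rule irreducibleI)
    show "- p \<noteq> 0" using \<open>p \<noteq> 0\<close> by simp
    show "\<not> (- p) dvd 1" using assms(1) by (simp add: irreducible_not_unit)
    fix a b assume "- p = a * b"
    then have "p = (- a) * b" by (metis minus_minus minus_mult_left)
    from irreducibleD[OF assms(1) this] show "a dvd 1 \<or> b dvd 1" by simp
  qed
  moreover have "homogeneous d (- p)" using assms(2) by (simp add: homogeneous_def)
  ultimately show ?thesis using assms by (auto simp: prime_form_def linorder_neq_iff)
qed

text \<open>Lexicographic induction on degree and \<open>coeff_norm\<close>. A reducible form is a
  product of two forms of smaller degree, or one factor is a non-unit integer; then the degree stays
  and \<open>coeff_norm\<close> drops.\<close>

lemma prime_form_factorization:
  fixes F :: "('n::{finite,linorder}, int) mvpoly"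
  assumes "homogeneous d F" "F \<noteq> 0"
  shows "\<exists>c ps. c \<noteq> 0 \<and> F = mconst c * prod_list ps \<and> (\<forall>p\<in>set ps. prime_form p)"
  using assms
proof (induction d arbitrary: F rule: less_induct)
  case (less d)
  note degree_IH = less.IH
  show ?case using less.prems
  proof (induction "coeff_norm F" arbitrary: F rule: less_induct)
    case less
    note F = less.prems
    show ?case
    proof (cases "d = 0")
      case True
      with F(1) have "homogeneous 0 F" by simp
      then have "F = mconst (Poly_Mapping.lookup F 0)" by (rule iffD1[OF homogeneous_0_iff])
      moreover from this F(2) have "Poly_Mapping.lookup F 0 \<noteq> 0" by (metis single_zero)
      ultimately show ?thesis by (intro exI[of _ "Poly_Mapping.lookup F 0"] exI[of _ "[]"]) simp
    next
      case False
      then have "\<not> F dvd 1" using is_unit_homogeneous F by blast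
      show ?thesis
      proof (cases "irreducible F")
        case True
        then consider "prime_form F" | "prime_form (- F)"
          using irreducible_prime_form F False by blast
        then show ?thesis
        proof cases
          case 1
          then show ?thesis by (intro exI[of _ 1] exI[of _ "[F]"]) simp
        next
          case 2
          then show ?thesis by (intro exI[of _ "- 1"] exI[of _ "[- F]"]) (simp add: single_uminus)
        qed
      next
        case False
        with F \<open>\<not> F dvd 1\<close> obtain A B where AB: "F = A * B" "\<not> A dvd 1" "\<not> B dvd 1"
          by (auto simp: irreducible_def)
        from F AB obtain a b where hom: "homogeneous a A" "homogeneous b B" "a + b = d"
          by (metis homogeneous_factor)
        have nz: "A \<noteq> 0" "B \<noteq> 0" using F AB by auto
        have const: "\<exists>c ps. c \<noteq> 0 \<and> F = mconst c * prod_list ps \<and> (\<forall>p\<in>set ps. prime_form p)"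
          if GH: "F = G * H" "homogeneous 0 G" "homogeneous d H" "\<not> G dvd 1" for G H
        proof -
          have "\<exists>e. G = mconst e" using iffD1[OF homogeneous_0_iff GH(2)] ..
          then obtain e where e: "G = mconst e" ..
          then have "\<not> e dvd 1" using GH mconst_unit by blast
          then have "coeff_norm H < coeff_norm F"
            using coeff_norm_mconst_mult_less[of e H] F GH(1) e by simp
          moreover have "H \<noteq> 0" "e \<noteq> 0" using F GH(1) e by auto
          ultimately obtain c ps where H: "c \<noteq> 0" "H = mconst c * prod_list ps" "\<forall>p\<in>set ps. prime_form p"
            using less.hyps GH(3) by blast
          have "mconst (e * c) = (mconst e * mconst c :: ('n, int) mvpoly)" by (simp add: mult_single)
          then have "F = mconst (e * c) * prod_list ps" by (simp only: GH(1) e H(2) mult.assoc)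
          moreover have "e * c \<noteq> 0" using \<open>e \<noteq> 0\<close> H(1) by simp
          ultimately show ?thesis using H(3) by blast
        qed
        consider "a = 0" | "b = 0" | "a < d" "b < d" using hom(3) by linarith
        then show ?thesis
        proof cases
          case 1
          then show ?thesis using const[of A B] AB hom by simp
        next
          case 2
          then show ?thesis using const[of B A] AB hom by (simp add: mult.commute)
        next
          case 3
          obtain c ps where "c \<noteq> 0" "A = mconst c * prod_list ps" "\<forall>p\<in>set ps. prime_form p"
            using degree_IH[OF 3(1) hom(1) nz(1)] by blast
          moreover obtain e qs where "e \<noteq> 0" "B = mconst e * prod_list qs" "\<forall>p\<in>set qs. prime_form p"
            using degree_IH[OF 3(2) hom(2) nz(2)] by blast
          moreover have "mconst (c * e) = (mconst c * mconst e :: ('n, int) mvpoly)" by (simp add: mult_single)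
          then have "mconst c * prod_list ps * (mconst e * prod_list qs) = mconst (c * e) * prod_list (ps @ qs)"
            by (simp only: prod_list.append ac_simps)
          ultimately show ?thesis using AB(1)
            by (intro exI[of _ "c * e"] exI[of _ "ps @ qs"]) auto
        qed
      qed
    qed
  qed
qed

text \<open>A prime form occurring twice would be a square factor of positive degree. Hence the list
  of factors is distinct and becomes the finite set that supports a reduced divisor.\<close>

lemma reduced_form_factorization:
  fixes F :: "('n::{finite,linorder}, int) mvpoly"
  assumes "homogeneous d F" "reduced_form F"
  obtains c K where "c \<noteq> 0" "finite K" "F = of_int c * \<Prod>K" "\<forall>p\<in>K. prime_form p"
proof -
  have "F \<noteq> 0" using assms by (simp add: reduced_form_def)
  with assms(1) obtain c ps where c: "c \<noteq> 0" "F = mconst c * prod_list ps" "\<forall>p\<in>set ps. prime_form p"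
    using prime_form_factorization by blast
  have "distinct ps"
  proof (rule ccontr)
    assume "\<not> distinct ps"
    then obtain xs ys zs p where ps: "ps = xs @ [p] @ ys @ [p] @ zs"
      using not_distinct_decomp by blast
    have "F = p ^ 2 * (mconst c * (prod_list xs * prod_list ys * prod_list zs))"
      by (simp add: c(2) ps power2_eq_square ac_simps)
    then have "total_degree p = 0" using assms(2) by (simp add: reduced_form_def)
    moreover have "prime_form p" using c(3) ps by simp
    then obtain e where "e > 0" "homogeneous e p" "p \<noteq> 0" by (auto simp: prime_form_def irreducible_def)
    ultimately show False using total_degree_homogeneous by fastforce
  qed
  then have "prod_list ps = \<Prod>(set ps)" by (metis prod.distinct_set_conv_list list.map_ident)
  moreover have "mconst c = (of_int c :: ('n, int) mvpoly)" by (simp flip: single_of_int)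
  ultimately show ?thesis using c that[of c "set ps"] by simp
qed

section \<open>Sets of points that are not Zariski dense\<close>

lemma peval_on_line:
  "\<exists>P. \<forall>t. poly P t = peval \<phi> p (a + t *s b)"
  for a :: "'a::comm_ring_1^'n::finite"
proof (intro exI allI)
  fix t
  show "poly (\<Sum>m\<in>Poly_Mapping.keys p. [:\<phi> (Poly_Mapping.lookup p m):] *
      (\<Prod>i\<in>UNIV. [:a $ i, b $ i:] ^ Poly_Mapping.lookup m i)) t = peval \<phi> p (a + t *s b)"
    by (simp add: poly_sum poly_prod poly_power peval_def)
qed

text \<open>On the line through a and b both polynomials restrict to nonzero polynomials in one
  parameter, whose product has only finitely many roots. This is the irreducibility of affine
  space.\<close>

lemma peval_common_nonzero:
  fixes a b :: "complex^'n::finite"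
  assumes "peval \<phi> p a \<noteq> 0" "peval \<psi> q b \<noteq> 0"
  shows "\<exists>z. peval \<phi> p z \<noteq> 0 \<and> peval \<psi> q z \<noteq> 0"
proof -
  obtain P Q where P: "\<And>t. poly P t = peval \<phi> p (a + t *s (b - a))"
    and Q: "\<And>t. poly Q t = peval \<psi> q (a + t *s (b - a))"
    using peval_on_line by metis
  have "poly P 0 \<noteq> 0" "poly Q 1 \<noteq> 0" using assms by (simp_all add: P Q)
  then have "P * Q \<noteq> 0" by auto
  then have "finite {t. poly (P * Q) t = 0}" by (rule poly_roots_finite)
  then have "{t. poly (P * Q) t = 0} \<noteq> UNIV" using infinite_UNIV_char_0 by metis
  then obtain t where "poly (P * Q) t \<noteq> 0" by blast
  then show ?thesis using P[of t] Q[of t] by auto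
qed

text \<open>
  Substituting \<open>z\<^sub>i = t ^ (K ^ i)\<close> with a generic \<open>K\<close> sends distinct monomials of \<open>p\<close> to distinct powers
  of \<open>t\<close>.
\<close>

lemma peval_nonzero:
  fixes p :: "('n::finite, 'b::zero) mvpoly"
  assumes "p \<noteq> 0" and \<phi>: "\<And>c. \<phi> c = (0::complex) \<longleftrightarrow> c = 0"
  shows "\<exists>z. peval \<phi> p z \<noteq> 0"
proof -
  define idx :: "'n \<Rightarrow> nat" where "idx = to_nat"
  have idx: "idx i = idx j \<longleftrightarrow> i = j" for i j by (simp add: idx_def)
  \<comment> \<open>At k this polynomial takes the difference of the exponents of t that arise from
    m and l. It suffices that k avoids the roots of the finitely many Q m l with m and l
    distinct.\<close>
  define Q where "Q m l = (\<Sum>i\<in>UNIV. monom (int (Poly_Mapping.lookup m i) - int (Poly_Mapping.lookup l i)) (idx i))"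
    for m l :: "'n \<Rightarrow>\<^sub>0 nat"
  have Q0: "Q m l \<noteq> 0" if ml: "m \<noteq> l" for m l
  proof -
    obtain k where k: "Poly_Mapping.lookup m k \<noteq> Poly_Mapping.lookup l k"
      using ml poly_mapping_eqI[of m l] by auto
    have "coeff (Q m l) (idx k) =
        (\<Sum>i\<in>UNIV. if i = k then int (Poly_Mapping.lookup m k) - int (Poly_Mapping.lookup l k) else 0)"
      unfolding Q_def coeff_sum by (intro sum.cong) (auto simp: idx)
    with k show ?thesis by auto
  qed
  let ?K = "Poly_Mapping.keys p"
  define B where "B = (\<Union>m\<in>?K. \<Union>l\<in>?K - {m}. {k. poly (Q m l) k = 0})"
  have "finite B"
    unfolding B_def by (intro finite_UN_I finite_keys finite_Diff poly_roots_finite Q0) auto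
  then have "finite (int -` B)" by (rule finite_vimageI) (simp add: inj_on_def)
  from ex_new_if_finite[OF infinite_UNIV_nat this] obtain k where "int k \<notin> B" by auto
  then have k: "poly (Q m l) (int k) \<noteq> 0" if "m \<in> ?K" "l \<in> ?K" "m \<noteq> l" for m l
    using that by (auto simp: B_def)
  define w where "w m = (\<Sum>i\<in>UNIV. Poly_Mapping.lookup m i * k ^ idx i)" for m :: "'n \<Rightarrow>\<^sub>0 nat"
  have "poly (Q m l) (int k) = int (w m) - int (w l)" for m l
    by (simp add: Q_def w_def poly_sum poly_monom algebra_simps sum_subtractf)
  then have w: "w m \<noteq> w l" if "m \<in> ?K" "l \<in> ?K" "m \<noteq> l" for m l using k[OF that] by simp
  define P where "P = (\<Sum>m\<in>?K. monom (\<phi> (Poly_Mapping.lookup p m)) (w m))"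
  obtain m where m: "m \<in> ?K"
    using assms(1) by (metis empty_iff in_keys_iff lookup_zero poly_mapping_eqI)
  have "coeff P (w m) = (\<Sum>l\<in>?K. if l = m then \<phi> (Poly_Mapping.lookup p m) else 0)"
    unfolding P_def coeff_sum by (intro sum.cong) (use w m in auto)
  also have "\<dots> \<noteq> 0" using m by (simp add: \<phi> in_keys_iff)
  finally have "P \<noteq> 0" by auto
  then have "{t. poly P t = 0} \<noteq> UNIV" using poly_roots_finite infinite_UNIV_char_0 by metis
  then obtain t where t: "poly P t \<noteq> 0" by blast
  have "poly P t = peval \<phi> p (\<chi> i. t ^ (k ^ idx i))"
    by (simp add: P_def poly_sum poly_monom peval_def w_def power_sum power_mult[symmetric] mult.commute[of "_ ^ _"])
  with t show ?thesis by metis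
qed

text \<open>Requiring a nonzero complex value of g, in place of g being nonzero, makes products of
  equations available through \<open>peval_common_nonzero\<close>.\<close>

definition in_hypersurface :: "((int, 'n::finite) vec) set \<Rightarrow> bool" where
  "in_hypersurface T \<longleftrightarrow> (\<exists>(g :: ('n, rat) mvpoly) d. homogeneous d g \<and>
     (\<exists>z. peval of_rat g z \<noteq> (0::complex)) \<and> (\<forall>x\<in>T. peval of_rat g (complex_coords x) = (0::complex)))"

lemma in_hypersurface_subset: "in_hypersurface T \<Longrightarrow> S \<subseteq> T \<Longrightarrow> in_hypersurface S"
  unfolding in_hypersurface_def by blast

lemma in_hypersurface_Un:
  assumes "in_hypersurface S" "in_hypersurface T"
  shows "in_hypersurface (S \<union> T)"
proof -
  from assms obtain g d h e where
    "homogeneous d g" "\<exists>z. peval of_rat g z \<noteq> (0::complex)" "\<forall>x\<in>S. peval of_rat g (complex_coords x) = (0::complex)"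
    "homogeneous e h" "\<exists>z. peval of_rat h z \<noteq> (0::complex)" "\<forall>x\<in>T. peval of_rat h (complex_coords x) = (0::complex)"
    unfolding in_hypersurface_def by blast
  then show ?thesis
    unfolding in_hypersurface_def
    by (intro exI[of _ "g * h"] exI[of _ "d + e"])
      (auto simp: peval_of_rat.peval_mult intro: homogeneous_mult peval_common_nonzero)
qed

text \<open>Two coordinates give a hyperplane through x: X_i = 0 if x_i = 0, and otherwise x_i X_j =
  x_j X_i. With one coordinate the projective space would be a single point, which is dense.\<close>

lemma in_hypersurface_singleton:
  fixes x :: "(int, 'n::finite) vec"
  assumes "CARD('n) \<ge> 2"
  shows "in_hypersurface {x}"
proof -
  obtain i j :: 'n where ij: "i \<noteq> j"
    using assms by (metis (full_types) UNIV_I card_2_iff' ex_card[of 2 "UNIV :: 'n set"])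
  let ?X = "\<lambda>i c. Poly_Mapping.single (Poly_Mapping.single i 1) c :: ('n, rat) mvpoly"
  have X: "peval of_rat (?X i c) z = of_rat c * (z $ i :: complex)" for i c z
    by (simp add: peval_of_rat.peval_single monomial_value_single)
  have hom: "homogeneous 1 (?X i c)" for i c by (metis homogeneous_single mdeg_single)
  show ?thesis
  proof (cases "x $ i = 0")
    case True
    have "homogeneous 1 (?X i 1)" by (rule hom)
    moreover have "peval of_rat (?X i 1) (axis i 1) \<noteq> (0::complex)"
      unfolding X by (simp add: axis_def)
    moreover have "peval of_rat (?X i 1) (complex_coords x) = (0::complex)"
      unfolding X using True by (simp add: complex_coords_def)
    ultimately show ?thesis unfolding in_hypersurface_def by blast
  next
    case False
    let ?g = "?X j (of_int (x $ i)) + ?X i (- of_int (x $ j))"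
    have g: "peval of_rat ?g z = of_int (x $ i) * z $ j - (of_int (x $ j) * z $ i :: complex)" for z
      by (simp only: peval_of_rat.peval_add X) (simp add: of_rat_minus)
    have "homogeneous 1 ?g" by (intro homogeneous_add hom)
    moreover have "peval of_rat ?g (axis j 1) \<noteq> (0::complex)"
      unfolding g using False ij by (simp add: axis_def)
    moreover have "peval of_rat ?g (complex_coords x) = (0::complex)"
      unfolding g by (simp add: complex_coords_def)
    ultimately show ?thesis unfolding in_hypersurface_def by blast
  qed
qed

lemma in_hypersurface_finite:
  fixes T :: "((int, 'n::finite) vec) set"
  assumes "CARD('n) \<ge> 2" "finite T"
  shows "in_hypersurface T"
  using assms(2)
proof (induction T rule: finite_induct)
  case empty
  show ?case
    unfolding in_hypersurface_def by (intro exI[of _ 1] exI[of _ 0]) (simp add: homogeneous_1)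
next
  case (insert x T)
  then show ?case
    using in_hypersurface_Un[OF in_hypersurface_singleton[OF assms(1), of x]] by simp
qed

lemma in_hypersurface_zariski_closed:
  assumes "zariski_closed Y" "Y \<noteq> - {0}"
  shows "in_hypersurface {x. complex_coords x \<in> Y}"
proof -
  from assms(1) obtain G :: "('a, rat) mvpoly set"
    where G: "\<And>g. g \<in> G \<Longrightarrow> \<exists>d. homogeneous d g" "Y = {z. z \<noteq> 0 \<and> (\<forall>g\<in>G. peval of_rat g z = 0)}"
    unfolding zariski_closed_def by blast
  with assms(2) obtain z where "z \<noteq> 0" "z \<notin> Y" by auto
  then obtain g where "g \<in> G" "peval of_rat g z \<noteq> (0::complex)" using G by blast
  with G show ?thesis unfolding in_hypersurface_def by blast
qed

lemma in_hypersurface_form: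
  fixes F :: "('n::finite, int) mvpoly"
  assumes "homogeneous d F" "F \<noteq> 0"
  shows "in_hypersurface {x. peval id F x = 0}"
proof -
  let ?g = "Poly_Mapping.map rat_of_int F"
  have g: "peval of_rat ?g z = (peval of_int F z :: complex)" for z
    by (subst peval_map) (auto simp: comp_def)
  have "Poly_Mapping.keys ?g \<subseteq> Poly_Mapping.keys F"
    by (auto simp: in_keys_iff map.rep_eq when_def)
  then have "homogeneous d ?g" using assms(1) by (auto simp: homogeneous_def)
  moreover have "\<exists>z. peval of_int F z \<noteq> (0::complex)"
    by (rule peval_nonzero[OF assms(2)]) simp
  ultimately show ?thesis
    unfolding in_hypersurface_def by (intro exI[of _ ?g] exI[of _ d]) (auto simp: g peval_complex_coords)
qed

lemma complex_coords_nonzero: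
  assumes "x \<in> rat_points"
  shows "complex_coords x \<noteq> 0"
proof
  assume "complex_coords x = 0"
  then have "x $ i = 0" for i by (auto simp: complex_coords_def vec_eq_iff)
  with assms show False by (simp add: rat_points_def)
qed

lemma in_hypersurface_not_dense:
  assumes "in_hypersurface T" "T \<subseteq> rat_points"
  shows "\<not> zariski_dense T"
proof -
  from assms(1) obtain g :: "('a, rat) mvpoly" and d z where g: "homogeneous d g"
    "peval of_rat g z \<noteq> (0::complex)" "\<And>x. x \<in> T \<Longrightarrow> peval of_rat g (complex_coords x) = (0::complex)"
    unfolding in_hypersurface_def by blast
  fix i :: 'a
  \<comment> \<open>The point z may be 0, for instance if g is constant. Asking for a nonzero i-th
    coordinate as well produces a point of projective space off the hypersurface.\<close>
  have "peval of_int (mvar i) (axis i 1) \<noteq> (0::complex)" by (simp add: peval_mvar)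
  from peval_common_nonzero[OF g(2) this] obtain w
    where w: "peval of_rat g w \<noteq> (0::complex)" "w $ i \<noteq> 0" by (auto simp: peval_mvar)
  then have "w \<noteq> 0" by auto
  let ?Y = "{z. z \<noteq> 0 \<and> (\<forall>g\<in>{g}. peval of_rat g z = (0::complex))}"
  have "zariski_closed ?Y" unfolding zariski_closed_def using g(1) by blast
  moreover have "complex_coords ` T \<subseteq> ?Y" using g(3) assms(2) complex_coords_nonzero by auto
  moreover have "?Y \<noteq> - {0}" using w(1) \<open>w \<noteq> 0\<close> by auto
  ultimately show ?thesis unfolding zariski_dense_def by blast
qed

section \<open>Vojta's conjecture for a hypersurface\<close>

lemma mvar_nonzero: "mvar i \<noteq> (0 :: ('n, int) mvpoly)"
  by (simp add: mvar_def)

text \<open>The degrees of two factors add up to 1, so one factor is an integer. It divides the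
  coefficient 1 of X_i and is a unit.\<close>

lemma prime_form_mvar:
  fixes i :: "'n::{finite,linorder}"
  shows "prime_form (mvar i)"
proof -
  have coeff: "Poly_Mapping.lookup (mvar i) (Poly_Mapping.single i 1) = 1"
    by (simp add: mvar_def)
  have const: "A dvd 1" if "mvar i = A * B" "homogeneous 0 A" for A B :: "('n, int) mvpoly"
  proof -
    define c where "c = Poly_Mapping.lookup A 0"
    have c: "A = mconst c" using iffD1[OF homogeneous_0_iff that(2)] by (simp only: c_def)
    have "c * Poly_Mapping.lookup B (Poly_Mapping.single i 1) = 1"
      using coeff that(1) lookup_mconst_mult[of c B] c by metis
    then have "c dvd 1" by (metis dvdI)
    then show ?thesis using mconst_unit c by metis
  qed
  have "irreducible (mvar i :: ('n, int) mvpoly)"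
  proof (rule irreducibleI)
    show "mvar i \<noteq> (0 :: ('n, int) mvpoly)" by (rule mvar_nonzero)
    show "\<not> mvar i dvd (1 :: ('n, int) mvpoly)"
      using is_unit_homogeneous homogeneous_mvar by (metis zero_neq_one)
    fix A B :: "('n, int) mvpoly" assume AB: "mvar i = A * B"
    then obtain a b where "homogeneous a A" "homogeneous b B" "a + b = 1"
      using homogeneous_mvar mvar_nonzero by (metis homogeneous_factor)
    moreover from \<open>a + b = 1\<close> have "a = 0 \<or> b = 0" by linarith
    ultimately show "A dvd 1 \<or> B dvd 1"
      using const[of A B] const[of B A] AB by (auto simp: mult.commute)
  qed
  then show ?thesis
    unfolding prime_form_def using homogeneous_mvar[of i] by (auto simp: mvar_def)
qed

lemma linearly_equivalent_refl: "linearly_equivalent D D"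
proof -
  have "zero_divisor 1 0"
    unfolding zero_divisor_def is_divisor_def effective_def by (auto intro: exI[of _ 1])
  then show ?thesis
    unfolding linearly_equivalent_def
    by (intro exI[of _ 1] exI[of _ 0] conjI) (auto simp: homogeneous_1)
qed

lemma zero_divisor_mvar: "zero_divisor (mvar i) (frag_of (mvar i))"
  unfolding zero_divisor_def is_divisor_def effective_def
  by (auto simp: prime_form_mvar when_def keys_frag_of intro!: exI[of _ 1])

lemma canonical_divisor_hyperplane:
  fixes j :: "'n::{finite,linorder}"
  shows "canonical_divisor (frag_cmul (- int CARD('n)) (frag_of (mvar j)))"
  unfolding canonical_divisor_def is_divisor_def
  using linearly_equivalent_refl prime_form_mvar by (auto simp: keys_frag_of)

lemma dir_deriv_mvar: "dir_deriv (peval of_int (mvar i)) z v = v $ i"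
proof -
  have "((\<lambda>t. z $ i + t * v $ i) has_field_derivative v $ i) (at 0)"
    by (auto intro!: derivative_eq_intros)
  then show ?thesis by (simp add: dir_deriv_def peval_mvar DERIV_imp_deriv)
qed

text \<open>The coordinate forms serve as sections. They define the identity embedding, so the
  hyperplane is already very ample.\<close>

lemma ample_hyperplane:
  fixes j :: "'n::{finite,linorder}"
  shows "ample (frag_of (mvar j))"
proof -
  have lin: "linearly_equivalent (frag_of (mvar i)) (frag_of (mvar j))" for i
    unfolding linearly_equivalent_def using zero_divisor_mvar homogeneous_mvar by blast
  have "very_ample (frag_of (mvar j))"
    unfolding very_ample_def
  proof (intro conjI exI[of _ "range mvar"] ballI allI impI)
    show "is_divisor (frag_of (mvar j))" by (simp add: is_divisor_def keys_frag_of prime_form_mvar)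
    show "finite (range mvar :: ('n, int) mvpoly set)" by simp
  next
    fix A :: "('n, int) mvpoly" assume "A \<in> range mvar"
    then show "\<exists>d. homogeneous d A" "\<exists>D. zero_divisor A D \<and> linearly_equivalent D (frag_of (mvar j))"
      using zero_divisor_mvar homogeneous_mvar lin by blast+
  next
    fix z :: "(complex, 'n) vec" assume "z \<noteq> 0"
    then show "\<exists>A\<in>range mvar. peval of_int A z \<noteq> (0::complex)" by (auto simp: peval_mvar vec_eq_iff)
  next
    fix z w :: "(complex, 'n) vec"
    assume "z \<noteq> 0 \<and> w \<noteq> 0 \<and> (\<exists>c::complex. \<forall>A\<in>range mvar. peval of_int A w = c * peval of_int A z)"
    then show "\<exists>c. w = c *s z" by (auto simp: peval_mvar vec_eq_iff)
  next
    fix z v :: "(complex, 'n) vec"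
    assume "z \<noteq> 0 \<and> (\<exists>c::complex. \<forall>A\<in>range mvar. dir_deriv (peval of_int A) z v = c * peval of_int A z)"
    then show "\<exists>c. v = c *s z" by (auto simp: peval_mvar dir_deriv_mvar vec_eq_iff)
  qed
  then show ?thesis
    unfolding ample_def by (auto simp: is_divisor_def keys_frag_of prime_form_mvar intro!: exI[of _ 1])
qed

section \<open>Degrees and counting functions of reduced divisors\<close>

lemma divisor_degree_superset:
  "finite A \<Longrightarrow> Poly_Mapping.keys D \<subseteq> A \<Longrightarrow>
    divisor_degree D = (\<Sum>p\<in>A. Poly_Mapping.lookup D p * int (total_degree p))"
  unfolding divisor_degree_def by (rule sum.mono_neutral_left) (auto simp: in_keys_iff)

lemma divisor_degree_add: "divisor_degree (D + E) = divisor_degree D + divisor_degree E"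
proof -
  let ?A = "Poly_Mapping.keys D \<union> Poly_Mapping.keys E"
  have "divisor_degree G = (\<Sum>p\<in>?A. Poly_Mapping.lookup G p * int (total_degree p))"
    if "Poly_Mapping.keys G \<subseteq> ?A" for G :: "'a divisor"
    using that by (intro divisor_degree_superset) auto
  then show ?thesis using keys_add[of D E] by (simp add: lookup_add distrib_right sum.distrib)
qed

lemma lookup_sum_frag_of:
  "finite K \<Longrightarrow> Poly_Mapping.lookup (\<Sum>p\<in>K. frag_of p) q = (if q \<in> K then 1 else 0)"
  by (auto simp: lookup_sum when_def)

lemma finite_primes_dvd: "a \<noteq> 0 \<Longrightarrow> finite {p. prime p \<and> int p dvd a}"
  by (rule finite_subset[of _ "{..nat \<bar>a\<bar>}"]) (auto dest!: dvd_imp_le_int simp: le_nat_iff)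

text \<open>At coprime coordinates the local height at p is the sum of - ln |q(x)|_p over q in K,
  positive only if p divides some q(x) and hence F(x). Primes dividing only c may occur on the right
  alone.\<close>

lemma truncated_counting_le:
  fixes K :: "('n::{finite,linorder}, int) mvpoly set" and x :: "(int, 'n) vec"
  assumes x: "x \<in> rat_points" and K: "finite K" "F = of_int c * \<Prod>K" and Fx: "peval id F x \<noteq> 0"
  shows "truncated_counting S (\<Sum>p\<in>K. frag_of p) x \<le> (\<Sum>p | prime p \<and> int p dvd peval id F x. ln (real p))"
  unfolding truncated_counting_def
proof (rule sum_mono2)
  show "finite {p. prime p \<and> int p dvd peval id F x}" by (rule finite_primes_dvd[OF Fx])
  show "{p. prime p \<and> Nonarchimedean p \<notin> S \<and> 0 < local_height (\<Sum>p\<in>K. frag_of p) (Nonarchimedean p) x}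
      \<subseteq> {p. prime p \<and> int p dvd peval id F x}"
  proof clarify
    fix p :: nat assume p: "prime p" "0 < local_height (\<Sum>p\<in>K. frag_of p) (Nonarchimedean p) x"
    show "int p dvd peval id F x"
    proof (rule ccontr)
      assume ndvd: "\<not> int p dvd peval id F x"
      have "\<not> int p dvd peval id q x" if "q \<in> K" for q
      proof -
        have "peval id q x dvd peval id F x"
          unfolding K(2) peval_id.peval_mult peval_id.peval_prod
          using that K(1) by (intro dvd_mult dvd_prodI)
        with ndvd show ?thesis using dvd_trans by blast
      qed
      then have "abs_at (Nonarchimedean p) (peval id q x) = 1" if "q \<in> K" for q
        using that by (metis abs_at.simps(2) div_by_1 dvd_0_right not_dvd_imp_multiplicity_0 power_0)
      moreover have "Poly_Mapping.keys (\<Sum>p\<in>K. frag_of p) = K"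
        by (auto simp: in_keys_iff lookup_sum_frag_of K(1) split: if_splits)
      ultimately have "local_height (\<Sum>p\<in>K. frag_of p) (Nonarchimedean p) x = 0"
        unfolding local_height_def using x p(1) by (simp add: max_abs_at_nonarchimedean del: abs_at.simps)
      with p show False by simp
    qed
  qed
qed (auto dest!: prime_ge_1_nat)

text \<open>A hyperplane serves as H, and - (N + 1) times it as canonical divisor, so the right side
  of the conjecture is (deg F - (N + 1) - \<epsilon>) h(x).\<close>

lemma vojta_hypersurface:
  fixes F :: "('n::{finite,linorder}, int) mvpoly"
  assumes vojta: "vojta_truncated TYPE('n)" and card: "CARD('n) \<ge> 2"
    and F: "homogeneous (total_degree F) F" "reduced_form F" "normal_crossings (form_locus F)"
    and \<epsilon>: "\<epsilon> > 0"
  shows "\<exists>T :: (int, 'n) vec set. in_hypersurface T \<and> (\<forall>x\<in>rat_points - T. peval id F x \<noteq> 0 \<and>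
    (real (total_degree F) - real CARD('n) - \<epsilon>) * ln (house x)
      \<le> (\<Sum>p | prime p \<and> int p dvd peval id F x. ln (real p)))"
proof -
  have "F \<noteq> 0" using F(2) by (simp add: reduced_form_def)
  obtain c K where K: "c \<noteq> 0" "finite K" "F = of_int c * \<Prod>K" "\<forall>p\<in>K. prime_form p"
    using reduced_form_factorization[OF F(1,2)] .
  define D where "D = (\<Sum>p\<in>K. frag_of p)"
  have lookup: "Poly_Mapping.lookup D p = (if p \<in> K then 1 else 0)" for p
    by (simp add: D_def lookup_sum_frag_of K(2))
  then have keys: "Poly_Mapping.keys D = K" by (auto simp: in_keys_iff split: if_splits)
  have of_int_const: "(of_int c :: ('n, int) mvpoly) = mconst c" by (simp flip: single_of_int)
  have support: "divisor_support D = form_locus F"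
    using K(1,2) by (auto simp: divisor_support_def form_locus_def keys K(3) peval_of_int.peval_mult
        peval_of_int.peval_prod of_int_const peval_of_int.peval_const)
  have hom: "homogeneous (total_degree p) p" if "p \<in> K" for p
    using K(4) that total_degree_homogeneous by (fastforce simp: prime_form_def irreducible_def)
  have "homogeneous (0 + (\<Sum>p\<in>K. total_degree p)) F"
    unfolding K(3) of_int_const
    by (intro homogeneous_mult homogeneous_prod hom) (metis homogeneous_single mdeg_0)
  then have "total_degree F = (\<Sum>p\<in>K. total_degree p)"
    using total_degree_homogeneous \<open>F \<noteq> 0\<close> by force
  then have deg_D: "divisor_degree D = int (total_degree F)"
    by (simp add: divisor_degree_def keys lookup)
  fix j :: 'n
  let ?H = "frag_of (mvar j) :: 'n divisor"
  let ?\<kappa> = "frag_cmul (- int CARD('n)) ?H"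
  have deg_mvar: "total_degree (mvar j) = 1"
    by (rule total_degree_homogeneous[OF homogeneous_mvar mvar_nonzero])
  have deg_H: "divisor_degree ?H = 1"
    by (simp add: divisor_degree_def keys_frag_of deg_mvar)
  have deg_\<kappa>: "divisor_degree ?\<kappa> = - int CARD('n)"
    by (subst divisor_degree_superset[of "{mvar j}"]) (auto simp: keys_frag_of deg_mvar)
  have "is_divisor D" "effective D" "reduced_divisor D"
    using K(4) by (auto simp: is_divisor_def effective_def reduced_divisor_def keys lookup)
  then have "\<exists>Y. zariski_closed Y \<and> Y \<noteq> - {0} \<and>
      (\<forall>C\<ge>0. finite {x \<in> rat_points. complex_coords x \<notin> Y \<and> complex_coords x \<notin> divisor_support D \<and>
         \<not> truncated_counting {Archimedean} D x \<ge> weil_height (?\<kappa> + D) x - \<epsilon> * weil_height ?H x - C})"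
    using vojta[unfolded vojta_truncated_def, rule_format, of "{Archimedean}" D ?\<kappa> ?H \<epsilon>]
      F(3) \<epsilon> canonical_divisor_hyperplane[of j] ample_hyperplane[of j]
    by (simp add: support rat_places_def)
  \<comment> \<open>The conjecture is used with C = 0; its finitely many exceptions are added to the
    hypersurface.\<close>
  then obtain Y where Y: "zariski_closed Y" "Y \<noteq> - {0}"
    and fin: "finite {x \<in> rat_points. complex_coords x \<notin> Y \<and> complex_coords x \<notin> divisor_support D \<and>
         \<not> truncated_counting {Archimedean} D x \<ge> weil_height (?\<kappa> + D) x - \<epsilon> * weil_height ?H x - 0}"
      (is "finite ?E")
    by (meson order_refl)
  let ?T = "{x. complex_coords x \<in> Y} \<union> {x. peval id F x = 0} \<union> ?E"
  have "in_hypersurface ?T"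
    by (intro in_hypersurface_Un in_hypersurface_zariski_closed in_hypersurface_form[OF F(1)]
        in_hypersurface_finite card fin Y \<open>F \<noteq> 0\<close>)
  moreover have "(real (total_degree F) - real CARD('n) - \<epsilon>) * ln (house x)
      \<le> (\<Sum>p | prime p \<and> int p dvd peval id F x. ln (real p))"
    if x: "x \<in> rat_points" "x \<notin> ?T" for x
  proof -
    have "peval id F x \<noteq> 0" using x by blast
    have "complex_coords x \<notin> divisor_support D"
      using \<open>peval id F x \<noteq> 0\<close> by (simp add: support form_locus_def peval_complex_coords)
    then have "weil_height (?\<kappa> + D) x - \<epsilon> * weil_height ?H x \<le> truncated_counting {Archimedean} D x"
      using x by auto
    also have "\<dots> \<le> (\<Sum>p | prime p \<and> int p dvd peval id F x. ln (real p))"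
      unfolding D_def by (rule truncated_counting_le[OF x(1) K(2,3)]) fact
    finally show ?thesis
      by (simp add: weil_height_def divisor_degree_add deg_\<kappa> deg_D deg_H left_diff_distrib)
  qed
  ultimately show ?thesis by (intro exI[of _ ?T]) blast
qed

section \<open>Orbits\<close>

text \<open>The forms have no common complex zero, so f(x) is a nonzero rational vector and the
  description in \<open>proj_map\<close> is well defined.\<close>

lemma proj_map_rat_points:
  fixes x :: "(int, 'n::{finite,linorder}) vec"
  assumes f: "morphism_of_degree d f" and x: "x \<in> rat_points"
  shows "proj_map f x \<in> rat_points"
    and "\<exists>c. c \<noteq> 0 \<and> (\<forall>i. peval id (f i) (\<chi> j. of_int (x $ j)) = c * of_int (proj_map f x $ i))"
proof -
  let ?y = "\<chi> i. peval id (f i) (\<chi> j. of_int (x $ j)) :: (rat, 'n) vec"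
  from f complex_coords_nonzero[OF x] obtain i where "peval of_rat (f i) (complex_coords x) \<noteq> (0::complex)"
    unfolding morphism_of_degree_def by blast
  moreover have "complex_coords x = (\<chi> j. of_rat ((\<chi> j. of_int (x $ j)) $ j))"
    by (simp add: complex_coords_def)
  ultimately have "peval id (f i) (\<chi> j. of_int (x $ j)) \<noteq> 0"
    using peval_of_rat_vec[of "f i" "\<chi> j. of_int (x $ j)", where 'a = complex] by auto
  then have "?y \<noteq> 0" by (auto simp: vec_eq_iff)
  from theI'[OF rat_points_representative[OF this]]
  show "proj_map f x \<in> rat_points"
    and "\<exists>c. c \<noteq> 0 \<and> (\<forall>i. peval id (f i) (\<chi> j. of_int (x $ j)) = c * of_int (proj_map f x $ i))"
    unfolding proj_map_def by simp_all
qed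

text \<open>The Northcott property, here for integer vectors.\<close>

lemma finite_house_le: "finite {x :: (int, 'n::finite) vec. house x \<le> B}"
proof (rule finite_subset)
  let ?A = "{- \<lceil>B\<rceil>..\<lceil>B\<rceil>}"
  show "{x :: (int, 'n) vec. house x \<le> B} \<subseteq> vec_lambda ` {f. \<forall>i. f i \<in> ?A}"
  proof
    fix x :: "(int, 'n) vec" assume "x \<in> {x. house x \<le> B}"
    then have "real_of_int \<bar>x $ i\<bar> \<le> B" for i using abs_le_house[of x i] by auto
    then have "\<bar>x $ i\<bar> \<le> \<lceil>B\<rceil>" for i by (meson ceiling_mono ceiling_of_int le_of_int_ceiling of_int_le_iff order_trans)
    then have "vec_nth x \<in> {f. \<forall>i. f i \<in> ?A}" by (simp add: abs_le_iff minus_le_iff)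
    moreover have "x = vec_lambda (vec_nth x)" by simp
    ultimately show "x \<in> vec_lambda ` {f. \<forall>i. f i \<in> ?A}" by blast
  qed
  show "finite (vec_lambda ` {f :: 'n \<Rightarrow> int. \<forall>i. f i \<in> ?A})"
    using finite_set_of_finite_funs[of "UNIV :: 'n set" ?A] by simp
qed

lemma ln_abs_peval_le:
  fixes F :: "('n::finite, int) mvpoly"
  assumes "homogeneous e F"
  shows "\<exists>A\<ge>0. \<forall>x. 1 \<le> house x \<longrightarrow> peval id F x \<noteq> 0 \<longrightarrow>
    ln \<bar>real_of_int (peval id F x)\<bar> \<le> real e * ln (house x) + A"
proof -
  define B where "B = (\<Sum>m\<in>Poly_Mapping.keys F. \<bar>Poly_Mapping.lookup F m\<bar>)"
  have "B \<ge> 0" by (simp add: B_def sum_nonneg)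
  \<comment> \<open>B + 1 in place of B makes the additive constant nonnegative.\<close>
  have "ln \<bar>real_of_int (peval id F x)\<bar> \<le> real e * ln (house x) + ln (real_of_int B + 1)"
    if x: "1 \<le> house x" "peval id F x \<noteq> 0" for x
  proof -
    obtain j where j: "house x = real_of_int \<bar>x $ j\<bar>" using house_attained by blast
    have "\<bar>x $ i\<bar> \<le> \<bar>x $ j\<bar>" for i using abs_le_house[of x i] j by linarith
    then have "\<bar>peval id F x\<bar> \<le> B * \<bar>x $ j\<bar> ^ e"
      unfolding B_def using abs_peval_le[of x "\<bar>x $ j\<bar>" F e id] x(1) j assms
      by (simp add: homogeneous_def)
    then have "real_of_int \<bar>peval id F x\<bar> \<le> of_int (B * \<bar>x $ j\<bar> ^ e)" by (simp only: of_int_le_iff)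
    also have "\<dots> \<le> (real_of_int B + 1) * house x ^ e"
      by (simp add: j mult_right_mono)
    finally have "ln (real_of_int \<bar>peval id F x\<bar>) \<le> ln ((real_of_int B + 1) * house x ^ e)"
      using x(2) by (intro ln_mono) auto
    also have "\<dots> = real e * ln (house x) + ln (real_of_int B + 1)"
      using x(1) \<open>B \<ge> 0\<close> by (subst ln_mult) (auto simp: ln_realpow)
    finally show ?thesis by simp
  qed
  moreover have "ln (real_of_int B + 1) \<ge> 0" using \<open>B \<ge> 0\<close> by simp
  ultimately show ?thesis by blast
qed

text \<open>The left side is the logarithm of the radical of a.\<close>

lemma sum_ln_primes_dvd_le:
  assumes "a \<noteq> 0"
  shows "(\<Sum>p | prime p \<and> int p dvd a. ln (real p)) \<le> ln \<bar>real_of_int a\<bar>"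
proof -
  define n where "n = nat \<bar>a\<bar>"
  have "n \<noteq> 0" using assms by (simp add: n_def)
  have P: "{p. prime p \<and> int p dvd a} = prime_factors n"
    using \<open>n \<noteq> 0\<close> by (auto simp: n_def in_prime_factors_iff nat_dvd_iff dvd_nat_abs_iff int_dvd_int_iff)
  have "(\<Prod>p\<in>prime_factors n. p) \<le> (\<Prod>p\<in>prime_factors n. p ^ multiplicity p n)"
    by (intro prod_mono conjI self_le_power)
      (auto simp: in_prime_factors_iff prime_ge_1_nat prime_multiplicity_gt_zero_iff)
  also have "\<dots> = n" using prime_factorization_nat[of n] \<open>n \<noteq> 0\<close> by simp
  finally have le: "(\<Prod>p\<in>prime_factors n. p) \<le> n" .
  have "(\<Sum>p\<in>prime_factors n. ln (real p)) = ln (real (\<Prod>p\<in>prime_factors n. p))"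
    by (simp, subst ln_prod) (auto simp: in_prime_factors_iff prime_gt_0_nat)
  moreover have "0 < (\<Prod>p\<in>prime_factors n. p)"
    by (intro prod_pos) (auto simp: in_prime_factors_iff prime_gt_0_nat)
  then have "ln (real (\<Prod>p\<in>prime_factors n. p)) \<le> ln (real n)"
    using le by (intro ln_mono) (simp_all only: of_nat_le_iff of_nat_0_less_iff)
  ultimately show ?thesis unfolding P using assms by (simp add: n_def)
qed

lemma sum_UN_le:
  fixes g :: "'a \<Rightarrow> real"
  assumes "finite M" "\<And>m. m \<in> M \<Longrightarrow> finite (B m)" "\<And>m b. m \<in> M \<Longrightarrow> b \<in> B m \<Longrightarrow> 0 \<le> g b"
  shows "sum g (\<Union>m\<in>M. B m) \<le> (\<Sum>m\<in>M. sum g (B m))"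
  using assms
proof (induction M rule: finite_induct)
  case (insert m M)
  have "sum g (B m \<union> (\<Union>m\<in>M. B m)) + sum g (B m \<inter> (\<Union>m\<in>M. B m)) = sum g (B m) + sum g (\<Union>m\<in>M. B m)"
    using insert by (intro sum.union_inter) auto
  moreover have "0 \<le> sum g (B m \<inter> (\<Union>m\<in>M. B m))" using insert by (intro sum_nonneg) auto
  ultimately show ?case using insert by force
qed simp

lemma sum_ln_primes_zsigmondy_le:
  assumes n: "n \<in> zsigmondy_set a" "a n \<noteq> 0"
  shows "(\<Sum>p | prime p \<and> int p dvd a n. ln (real p)) \<le> (\<Sum>m | m < n \<and> a m \<noteq> 0. ln \<bar>real_of_int (a m)\<bar>)"
proof -
  let ?P = "\<lambda>m. {p. prime p \<and> int p dvd a m}"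
  let ?M = "{m. m < n \<and> a m \<noteq> 0}"
  have "?P n \<subseteq> (\<Union>m\<in>?M. ?P m)"
    using n(1) by (auto simp: zsigmondy_set_def primitive_prime_divisor_def)
  then have "(\<Sum>p\<in>?P n. ln (real p)) \<le> (\<Sum>p\<in>(\<Union>m\<in>?M. ?P m). ln (real p))"
    by (intro sum_mono2) (auto simp: finite_primes_dvd dest!: prime_ge_1_nat)
  also have "\<dots> \<le> (\<Sum>m\<in>?M. \<Sum>p\<in>?P m. ln (real p))"
    by (rule sum_UN_le) (auto simp: finite_primes_dvd dest!: prime_ge_1_nat)
  also have "\<dots> \<le> (\<Sum>m\<in>?M. ln \<bar>real_of_int (a m)\<bar>)"
    by (intro sum_mono sum_ln_primes_dvd_le) auto
  finally show ?thesis .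
qed

text \<open>The inequalities (d - 1) h(m) \<le> h(m + 1) - h(m) + C telescope.\<close>

lemma geometric_growth_sum_le:
  fixes h :: "nat \<Rightarrow> real"
  assumes "\<And>n. d * h n \<le> h (Suc n) + C" "0 \<le> h 0"
  shows "(d - 1) * (\<Sum>m<n. h m) \<le> h n + real n * C"
proof (induction n)
  case (Suc n)
  have "(d - 1) * (\<Sum>m<Suc n. h m) \<le> (h n + real n * C) + (d - 1) * h n"
    using Suc by (simp add: distrib_left)
  also have "\<dots> \<le> h (Suc n) + real (Suc n) * C"
    using assms(1)[of n] by (simp add: algebra_simps)
  finally show ?case .
qed (use assms in simp)

lemma geometric_growth_superlinear:
  fixes h :: "nat \<Rightarrow> real"
  assumes h: "\<And>n. d * h n \<le> h (Suc n) + C" and d: "3 \<le> d" and "0 \<le> C" and start: "C + 1 \<le> h k" and "0 < \<delta>"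
  shows "\<exists>N. \<forall>n\<ge>N. A * real n < \<delta> * h n"
proof -
  \<comment> \<open>The invariant C + 1 \<le> h absorbs the error term: 3 h - C is at least 2 h + 1,
    so h doubles at every step.\<close>
  have growth: "C + 1 \<le> h (k + j) \<and> 2 ^ j \<le> h (k + j)" for j
  proof (induction j)
    case 0
    then show ?case using start \<open>0 \<le> C\<close> by simp
  next
    case (Suc j)
    then have "3 * h (k + j) \<le> d * h (k + j)" using d \<open>0 \<le> C\<close> by (intro mult_right_mono) auto
    then have "2 * h (k + j) + 1 \<le> h (k + Suc j)" using h[of "k + j"] Suc by simp
    then show ?case using Suc \<open>0 \<le> C\<close> by simp
  qed
  have "eventually (\<lambda>j. A * (real k + real j) < \<delta> * 2 ^ j) sequentially"
    using \<open>0 < \<delta>\<close> by real_asymp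
  then obtain J where J: "\<And>j. j \<ge> J \<Longrightarrow> A * (real k + real j) < \<delta> * 2 ^ j"
    by (auto simp: eventually_sequentially)
  have "A * real n < \<delta> * h n" if n: "n \<ge> k + J" for n
  proof -
    have "A * real n = A * (real k + real (n - k))" using n by simp
    also have "\<dots> < \<delta> * 2 ^ (n - k)" using n by (intro J) simp
    also have "\<dots> \<le> \<delta> * h (k + (n - k))" using growth \<open>0 < \<delta>\<close> by (intro mult_left_mono) auto
    finally show ?thesis using n by simp
  qed
  then show ?thesis by blast
qed

theorem theorem1:
  fixes f :: "'n::{finite,linorder} \<Rightarrow> ('n, rat) mvpoly"
    and F :: "('n, int) mvpoly"
    and P :: "(int, 'n) vec"
    and d :: nat
  assumes "CARD('n) \<ge> 2"
    and "vojta_truncated TYPE('n)"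
    and "d \<ge> 3"
    and "morphism_of_degree d f"
    and "homogeneous (total_degree F) F" and "total_degree F > 0"
    and "reduced_form F" and "normal_crossings (form_locus F)"
    and "real (total_degree F) > real CARD('n) * (1 + 1 / (real d - 2))"
    and "P \<in> rat_points"
  shows "\<not> zariski_dense
    {(proj_map f ^^ n) P | n. n \<in> zsigmondy_set (\<lambda>k. peval id F ((proj_map f ^^ k) P))}"
proof -
  define x where "x n = (proj_map f ^^ n) P" for n
  define h where "h n = ln (house (x n))" for n
  define e where "e = real (total_degree F)"
  have x: "x n \<in> rat_points" for n
    by (induction n) (auto simp: x_def assms(10) proj_map_rat_points(1)[OF assms(4)])
  have house: "1 \<le> house (x n)" for n by (rule house_ge_1[OF x])
  then have h0: "0 \<le> h n" for n by (simp add: h_def)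
  have "\<exists>C\<ge>0. \<forall>n. real d * h n \<le> h (Suc n) + C"
  proof -
    obtain K where K: "K > 0" "\<And>x y c. Gcd (range (\<lambda>i. x $ i)) = 1 \<Longrightarrow> Gcd (range (\<lambda>i. y $ i)) = 1 \<Longrightarrow> c \<noteq> 0 \<Longrightarrow>
      (\<And>i. peval id (f i) (\<chi> j. of_int (x $ j)) = c * of_int (y $ i)) \<Longrightarrow> house x ^ d \<le> K * house y"
      using house_image_lower_bound[OF assms(4)] by metis
    have "real d * h n \<le> h (Suc n) + \<bar>ln K\<bar>" for n
    proof -
      obtain c where "c \<noteq> 0" "\<And>i. peval id (f i) (\<chi> j. of_int (x n $ j)) = c * of_int (proj_map f (x n) $ i)"
        using proj_map_rat_points(2)[OF assms(4) x] by blast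
      moreover have "proj_map f (x n) = x (Suc n)" by (simp add: x_def)
      ultimately have "house (x n) ^ d \<le> K * house (x (Suc n))"
        using x[of n] x[of "Suc n"] by (intro K(2)[of "x n" "x (Suc n)" c]) (auto simp: rat_points_def)
      then have "ln (house (x n) ^ d) \<le> ln (K * house (x (Suc n)))"
        using house[of n] by (intro ln_mono) auto
      also have "\<dots> = ln K + h (Suc n)"
        using K(1) house[of "Suc n"] by (subst ln_mult) (auto simp: h_def)
      finally show ?thesis using house[of n] by (simp add: ln_realpow h_def)
    qed
    then show ?thesis by (intro exI[of _ "\<bar>ln K\<bar>"]) auto
  qed
  then obtain C where C: "C \<ge> 0" "\<And>n. real d * h n \<le> h (Suc n) + C" by blast
  \<comment> \<open>Half the gap between the Vojta coefficient e - (N + 1) and the coefficient e /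
    (d - 1) of the upper bound, so that a surplus of \<epsilon> h(x_n) remains.\<close>
  define \<epsilon> where "\<epsilon> = (e - real CARD('n) - e / (real d - 1)) / 2"
  have "\<epsilon> > 0"
  proof -
    have "real d - 2 > 0" using assms(3) by simp
    \<comment> \<open>Since 1 + 1 / (d - 2) = (d - 1) / (d - 2), the degree hypothesis says exactly
      that the gap, multiplied by d - 1, is positive.\<close>
    then have "real CARD('n) * (real d - 1) < e * (real d - 2)"
      using assms(9) by (simp add: e_def field_simps)
    then show ?thesis using assms(3) by (simp add: \<epsilon>_def field_simps)
  qed
  obtain T where T: "in_hypersurface T" "\<And>y. y \<in> rat_points \<Longrightarrow> y \<notin> T \<Longrightarrow> peval id F y \<noteq> 0"
    "\<And>y. y \<in> rat_points \<Longrightarrow> y \<notin> T \<Longrightarrow> (e - real CARD('n) - \<epsilon>) * ln (house y)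
      \<le> (\<Sum>p | prime p \<and> int p dvd peval id F y. ln (real p))"
    using vojta_hypersurface[OF assms(2,1,5,7,8) \<open>\<epsilon> > 0\<close>] unfolding e_def by blast
  obtain A where A: "A \<ge> 0" "\<And>y. 1 \<le> house y \<Longrightarrow> peval id F y \<noteq> 0 \<Longrightarrow>
      ln \<bar>real_of_int (peval id F y)\<bar> \<le> e * ln (house y) + A"
    using ln_abs_peval_le[OF assms(5)] unfolding e_def by blast
  let ?Z = "zsigmondy_set (\<lambda>k. peval id F (x k))"
  have bound: "\<epsilon> * h n \<le> (e * C / (real d - 1) + A) * real n" if n: "n \<in> ?Z" "x n \<notin> T" for n
  proof -
    have "(e - real CARD('n) - \<epsilon>) * h n \<le> (\<Sum>p | prime p \<and> int p dvd peval id F (x n). ln (real p))"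
      unfolding h_def by (rule T(3)[OF x n(2)])
    also have "\<dots> \<le> (\<Sum>m | m < n \<and> peval id F (x m) \<noteq> 0. ln \<bar>real_of_int (peval id F (x m))\<bar>)"
      by (rule sum_ln_primes_zsigmondy_le[OF n(1) T(2)[OF x n(2)]])
    also have "\<dots> \<le> (\<Sum>m | m < n \<and> peval id F (x m) \<noteq> 0. e * h m + A)"
      unfolding h_def by (intro sum_mono A(2) house) auto
    \<comment> \<open>Indices with F(x_m) = 0 are added back; their terms e h(x_m) + A are
      nonnegative.\<close>
    also have "\<dots> \<le> (\<Sum>m<n. e * h m + A)"
      using h0 A(1) by (intro sum_mono2) (auto simp: e_def)
    also have "\<dots> = e * (\<Sum>m<n. h m) + real n * A"
      by (simp add: sum.distrib sum_distrib_left)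
    also have "e * (\<Sum>m<n. h m) \<le> e * ((h n + real n * C) / (real d - 1))"
      using geometric_growth_sum_le[of "real d" h C n, OF C(2) h0] assms(3)
      by (intro mult_left_mono) (auto simp: e_def pos_le_divide_eq mult.commute)
    finally have "(e - real CARD('n) - \<epsilon>) * h n - e / (real d - 1) * h n \<le> (e * C / (real d - 1) + A) * real n"
      by (simp add: add_divide_distrib algebra_simps)
    moreover have "(e - real CARD('n) - \<epsilon>) * h n - e / (real d - 1) * h n = \<epsilon> * h n"
      by (simp add: \<epsilon>_def field_simps)
    ultimately show ?thesis by simp
  qed
  have "in_hypersurface {x n | n. n \<in> ?Z}"
  proof (cases "finite (range x)")
    \<comment> \<open>A preperiodic orbit shows no height growth, but it is a finite set and lies in
      a hypersurface.\<close>
    case True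
    then have "finite {x n | n. n \<in> ?Z}" by (rule finite_subset[rotated]) auto
    then show ?thesis by (rule in_hypersurface_finite[OF assms(1)])
  next
    case False
    \<comment> \<open>By the Northcott property an infinite orbit has unbounded height, so it passes
      the threshold at which doubling starts.\<close>
    have "\<exists>k. C + 1 \<le> h k"
    proof (rule ccontr)
      assume "\<not> ?thesis"
      then have "house (x n) \<le> exp (C + 1)" for n
        using house[of n] by (metis h_def less_eq_real_def linorder_not_le ln_ge_iff order_less_le_trans zero_less_one)
      then have "range x \<subseteq> {y. house y \<le> exp (C + 1)}" by auto
      with finite_house_le False show False using finite_subset by blast
    qed
    then obtain k where "C + 1 \<le> h k" by blast
    from geometric_growth_superlinear[of "real d" h C k \<epsilon> "e * C / (real d - 1) + A", OF C(2) _ C(1) this \<open>\<epsilon> > 0\<close>]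
    obtain N where N: "\<And>n. n \<ge> N \<Longrightarrow> (e * C / (real d - 1) + A) * real n < \<epsilon> * h n"
      using assms(3) by auto
    \<comment> \<open>Superlinear growth contradicts \<open>bound\<close> from N on. Outside T, only
      points with index below N remain.\<close>
    have "n < N" if "n \<in> ?Z" "x n \<notin> T" for n
      using bound[OF that] N[of n] by (meson linorder_not_le)
    then have "{x n | n. n \<in> ?Z} \<subseteq> T \<union> x ` {..<N}" by auto
    then show ?thesis
      by (rule in_hypersurface_subset[rotated])
        (intro in_hypersurface_Un T in_hypersurface_finite assms finite_imageI finite_lessThan)
  qed
  then have "\<not> zariski_dense {x n | n. n \<in> ?Z}"
    using x by (intro in_hypersurface_not_dense) auto
  then show ?thesis by (simp add: x_def)
qed

end
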